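(* Let $\lambda>0$ and let $\{(r_i,\varphi_i),i\in\mathbb N\}$ be a Poisson point process on $\mathbb R\times(\mathbb R/2\pi\mathbb Z)$ with intensity $\lambda\,dr\times d\varphi$. Let $\{F(t),t\in\mathbb R\}$ be a measurable process with values in $[0,\infty)$ such that $\int_{\mathbb R}\mathbb P[F(t)>a]\,dt<\infty$ for every $a>0$, and let $F_i$, $i\in\mathbb N$, be i.i.d. copies of $F$, independent of the Poisson process. Define $$\eta(x,y)=\max_{i\in\mathbb N}F_i(x\cos\varphi_i+y\sin\varphi_i-r_i),\quad(x,y)\in\mathbb R^2.$$ Then $\eta$ is a stationary max-i.d. process on $\mathbb R^2$.
   Context: A process $\{\eta(s),s\in\mathbb R^2\}$ is max-i.d. (max-infinitely divisible) if for every $n\in\mathbb N$ it has the same finite-dimensional distributions as the pointwise maximum of some $n$ i.i.d. processes. Stationary means that the finite-dimensional distributions are invariant under translations of $\mathbb R^2$. *)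

theory Defs
  imports "HOL-Probability.Probability" "HOL-Library.Real_Mod"
begin

section \<open>The circle of angles modulo \<open>2\<pi>\<close>\<close>

quotient_type angle = real / "\<lambda>x y :: real. [x = y] (rmod (2 * pi))"
  by (intro equivpI reflpI sympI transpI) (auto intro: rcong_sym rcong_trans)

lift_definition cos_angle :: "angle \<Rightarrow> real" is cos
  unfolding rcong_altdef by (elim exE) (use cos.plus_of_int[where ?'a = real] in simp)

lift_definition sin_angle :: "angle \<Rightarrow> real" is sin
  unfolding rcong_altdef by (elim exE) (use sin.plus_of_int[where ?'a = real] in simp)

instantiation angle :: topological_space
begin

definition open_angle :: "angle set \<Rightarrow> bool" where
  "open_angle U \<longleftrightarrow> open (abs_angle -` U)"

instance
  by standard (auto simp: open_angle_def vimage_Union intro: open_Int open_UN)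

end

lemma continuous_abs_angle: "continuous_on UNIV abs_angle"
  by (simp add: continuous_on_open_vimage open_angle_def)

text \<open>
  The measure \<open>d\<phi>\<close> on the circle, of total mass \<open>2\<pi>\<close>: Lebesgue measure on a fundamental
  domain, pushed forward to the quotient.
\<close>

definition angle_measure :: "angle measure" where
  "angle_measure = distr (restrict_space lborel {0..<2 * pi}) borel abs_angle"

definition line_intensity :: "real \<Rightarrow> (real \<times> angle) measure" where
  "line_intensity c = scale_measure (ennreal c) (lborel \<Otimes>\<^sub>M angle_measure)"

section \<open>Stochastic processes\<close>

definition stochastic_process :: "'w measure \<Rightarrow> ('t \<Rightarrow> 'w \<Rightarrow> real) \<Rightarrow> bool" where
  "stochastic_process M X \<longleftrightarrow> prob_space M \<and> (\<forall>t. X t \<in> borel_measurable M)"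

definition measurable_process :: "'w measure \<Rightarrow> (real \<Rightarrow> 'w \<Rightarrow> real) \<Rightarrow> bool" where
  "measurable_process M X \<longleftrightarrow> prob_space M \<and> (\<lambda>(\<omega>, t). X t \<omega>) \<in> borel_measurable (M \<Otimes>\<^sub>M borel)"

definition fdd :: "'w measure \<Rightarrow> ('t \<Rightarrow> 'w \<Rightarrow> real) \<Rightarrow> 't set \<Rightarrow> ('t \<Rightarrow> real) measure" where
  "fdd M X I = distr M (Pi\<^sub>M I (\<lambda>_. borel)) (\<lambda>\<omega>. \<lambda>t\<in>I. X t \<omega>)"

definition same_fdds ::
  "'w measure \<Rightarrow> ('t \<Rightarrow> 'w \<Rightarrow> real) \<Rightarrow> 'v measure \<Rightarrow> ('t \<Rightarrow> 'v \<Rightarrow> real) \<Rightarrow> bool" where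
  "same_fdds M X N Y \<longleftrightarrow> (\<forall>I. finite I \<longrightarrow> fdd M X I = fdd N Y I)"

definition stationary :: "'w measure \<Rightarrow> ('t::ab_group_add \<Rightarrow> 'w \<Rightarrow> real) \<Rightarrow> bool" where
  "stationary M X \<longleftrightarrow> stochastic_process M X \<and> (\<forall>h. same_fdds M (\<lambda>t. X (t + h)) M X)"

text \<open>The processes \<open>Y k\<close> for \<open>k < n\<close> are independent and identically distributed.\<close>

definition iid_processes :: "'w measure \<Rightarrow> nat \<Rightarrow> (nat \<Rightarrow> 't \<Rightarrow> 'w \<Rightarrow> real) \<Rightarrow> bool" where
  "iid_processes M n Y \<longleftrightarrow>
     (\<forall>k<n. stochastic_process M (Y k)) \<and>
     prob_space.indep_vars M (\<lambda>_. Pi\<^sub>M UNIV (\<lambda>_. borel)) (\<lambda>k \<omega> t. Y k t \<omega>) {..<n} \<and>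
     (\<forall>j<n. \<forall>k<n. same_fdds M (Y j) M (Y k))"

text \<open>
  The \<open>n\<close> i.i.d. processes may live on any probability space. HOL cannot quantify over its type,
  but fixing the type \<open>nat \<Rightarrow> 't \<Rightarrow> real\<close> loses nothing: given processes \<open>Y k\<close> on some probability
  space, push the measure forward along \<open>\<omega> \<mapsto> (\<lambda>k t. Y k t \<omega>)\<close> and use the coordinate processes.
\<close>

definition max_id :: "'w measure \<Rightarrow> ('t \<Rightarrow> 'w \<Rightarrow> real) \<Rightarrow> bool" where
  "max_id M X \<longleftrightarrow> stochastic_process M X \<and>
     (\<forall>n\<ge>1. \<exists>(N :: (nat \<Rightarrow> 't \<Rightarrow> real) measure) Y. prob_space N \<and> iid_processes N n Y \<and>
        same_fdds M X N (\<lambda>t \<omega>. MAX k\<in>{..<n}. Y k t \<omega>))"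

section \<open>Poisson point processes and marks\<close>

definition point_count :: "(nat \<Rightarrow> 'w \<Rightarrow> 's) \<Rightarrow> 's set \<Rightarrow> 'w \<Rightarrow> ennreal" where
  "point_count X B \<omega> = (\<Sum>i. indicator B (X i \<omega>))"

text \<open>
  The random points \<open>X i\<close> form a Poisson point process with intensity measure \<open>\<mu>\<close>. Sets of
  \<open>\<mu>\<close>-measure \<open>0\<close> are included in the first clause (they contain no points almost surely, as
  \<open>0 ^ 0 = 1\<close>).
\<close>

definition poisson_point_process :: "'w measure \<Rightarrow> 's measure \<Rightarrow> (nat \<Rightarrow> 'w \<Rightarrow> 's) \<Rightarrow> bool" where
  "poisson_point_process M \<mu> X \<longleftrightarrow>
     prob_space M \<and> (\<forall>i. X i \<in> measurable M \<mu>) \<and>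
     (\<forall>B\<in>sets \<mu>. emeasure \<mu> B < \<infinity> \<longrightarrow>
        (\<forall>k. measure M {\<omega>\<in>space M. point_count X B \<omega> = of_nat k} =
               exp (- measure \<mu> B) * measure \<mu> B ^ k / fact k)) \<and>
     (\<forall>n (B :: nat \<Rightarrow> 's set). B ` {..<n} \<subseteq> sets \<mu> \<and> disjoint_family_on B {..<n} \<longrightarrow>
        prob_space.indep_vars M (\<lambda>_. borel) (\<lambda>k. point_count X (B k)) {..<n})"

text \<open>
  The processes \<open>Fs i\<close> are i.i.d. copies of \<open>F\<close>, independent of the sequence of random points \<open>X\<close>.

  Independence of the \<open>\<sigma>\<close>-algebras generated by the variables \<open>Fs i t\<close> is not enough here: if \<open>U\<close>
  is uniform on \<open>[0, 1]\<close> and \<open>G t = indicator {U} t\<close>, then \<open>G\<close> is jointly measurable, and the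
  \<open>\<sigma>\<close>-algebra generated by the \<open>G t\<close> is trivial modulo null sets, hence independent of \<open>U\<close>; yet
  \<open>G U = 1\<close> although \<open>G t = 0\<close> almost surely for each \<open>t\<close>. To evaluate a copy at an independent
  random time one needs independence of \<open>\<sigma>\<close>-algebras \<open>A i\<close> that carry the copies as measurable
  processes. One may take \<open>A i\<close> to be generated by the variables \<open>Fs i t\<close> when \<open>Fs i\<close> is jointly
  measurable with respect to it. If \<open>Fs i t \<omega> = F t (W i \<omega>)\<close> with i.i.d. random elements \<open>W i\<close> of
  the probability space of \<open>F\<close> that are independent of \<open>X\<close>, one may take the one generated by \<open>W i\<close>.
\<close>

definition iid_copies_indep_of ::
  "'w measure \<Rightarrow> 's measure \<Rightarrow> (nat \<Rightarrow> 'w \<Rightarrow> 's) \<Rightarrow> 'v measure \<Rightarrow> (real \<Rightarrow> 'v \<Rightarrow> real) \<Rightarrow>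
   (nat \<Rightarrow> real \<Rightarrow> 'w \<Rightarrow> real) \<Rightarrow> bool" where
  "iid_copies_indep_of M S X N F Fs \<longleftrightarrow>
     (\<forall>i. same_fdds M (Fs i) N F) \<and>
     (\<exists>A :: nat \<Rightarrow> 'w measure.
        (\<forall>i. space (A i) = space M \<and> sets (A i) \<subseteq> sets M \<and>
             (\<lambda>(\<omega>, t). Fs i t \<omega>) \<in> borel_measurable (A i \<Otimes>\<^sub>M borel)) \<and>
        prob_space.indep_sets M
          (case_option (sets (vimage_algebra (space M) (\<lambda>\<omega> i. X i \<omega>) (Pi\<^sub>M UNIV (\<lambda>_. S))))
                       (\<lambda>i. sets (A i))) UNIV)"

section \<open>The process \<open>\<eta>\<close>\<close>

definition wave ::
  "(nat \<Rightarrow> 'w \<Rightarrow> real) \<Rightarrow> (nat \<Rightarrow> 'w \<Rightarrow> angle) \<Rightarrow> (nat \<Rightarrow> real \<Rightarrow> 'w \<Rightarrow> real) \<Rightarrow>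
   nat \<Rightarrow> real \<times> real \<Rightarrow> 'w \<Rightarrow> real" where
  "wave r \<phi> Fs i = (\<lambda>(x, y) \<omega>.
     Fs i (x * cos_angle (\<phi> i \<omega>) + y * sin_angle (\<phi> i \<omega>) - r i \<omega>) \<omega>)"

text \<open>
  The maximum over \<open>i\<close> is encoded as a real supremum, whose value is unspecified where the waves
  are unbounded. That it is almost surely attained is not part of the definition.
\<close>

definition eta ::
  "(nat \<Rightarrow> 'w \<Rightarrow> real) \<Rightarrow> (nat \<Rightarrow> 'w \<Rightarrow> angle) \<Rightarrow> (nat \<Rightarrow> real \<Rightarrow> 'w \<Rightarrow> real) \<Rightarrow>
   real \<times> real \<Rightarrow> 'w \<Rightarrow> real" where
  "eta r \<phi> Fs p \<omega> = (SUP i. wave r \<phi> Fs i p \<omega>)"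

end

theory Submission
  imports Defs
begin

text \<open>
  Write \<open>W i p\<close> for the value at the point \<open>p\<close> of the \<open>i\<close>-th wave, and \<open>\<mu>\<close> for the intensity measure
  of the Poisson process of lines \<open>s = (r, \<phi>)\<close>. At \<open>p\<close> the wave of the line \<open>s\<close> shows the value of its mark at the
  time \<open>phase p s\<close>. Everything follows from one formula (\<open>wave_laplace\<close>): for a finite set \<open>I\<close> of
  points and a measurable function \<open>\<Psi>\<close> on \<open>\<real>\<^sup>I\<close> with values in \<open>[0, 1]\<close>,

    \<open>E (\<Prod>i. \<Psi> (W i p)\<^sub>p\<^sub>\<in>\<^sub>I) = exp (- \<integral> (1 - E (\<Psi> (F (phase p s))\<^sub>p\<^sub>\<in>\<^sub>I)) d\<mu>(s))\<close>.

  Given the lines, the marks are independent, so that the expectation of a product over the first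
  \<open>m\<close> waves is that of the product of the averages \<open>h s = E (\<Psi> (F (phase p s))\<^sub>p\<^sub>\<in>\<^sub>I)\<close> over the lines
  (\<open>nn_integral_independent_marks\<close>). What remains is the Laplace functional of the Poisson process,
  \<open>E (\<Prod>i. h (X i)) = exp (- \<integral> (1 - h) d\<mu>)\<close> (\<open>poisson_laplace\<close>): for \<open>1 - h\<close> simple it is the product of
  generating functions of independent Poisson variables, and the general case is a monotone limit.
  The infinite products have factors in \<open>[0, 1]\<close> and are encoded as infima of finite products.

  The formula is used for four choices of \<open>\<Psi>\<close>.

  For the indicator of nonnegative values it shows that almost surely no wave is negative at a given
  point.

  For \<open>\<Psi> = z\<close> above a level \<open>a > 0\<close> and \<open>\<Psi> = 1\<close> below, where \<open>0 \<le> z < 1\<close>, the product vanishes if infinitely many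
  waves exceed \<open>a\<close> at \<open>p\<close>. Hence finitely many do so with probability at least \<open>exp (- (1 - z) v)\<close>, where
  \<open>v = 2 \<pi> \<lambda> \<integral> P (F t > a) dt\<close> is finite by hypothesis, and \<open>z\<close> tends to \<open>1\<close>. So the maximum is attained: if some
  wave is positive, only finitely many compete with it, and otherwise all waves vanish.

  For the indicator of the values below thresholds \<open>a p\<close> it gives the distribution function
  \<open>P (\<forall>p\<in>I. \<eta> p \<le> a p) = exp (- V I a)\<close>, where \<open>V I a\<close>, called \<open>excess\<close> below, is the \<open>\<mu>\<close>-integral of the
  probability that \<open>F (phase p s) > a p\<close> for some \<open>p \<in> I\<close>. A translation of the plane by \<open>h\<close> changes the phase of a
  line as a translation of \<open>r\<close> by an amount depending only on \<open>h\<close> and \<open>\<phi>\<close>, which leaves \<open>\<mu>\<close> invariant. Hence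
  \<open>V\<close> is invariant and \<open>\<eta>\<close> is stationary.

  For max-infinite divisibility colour the waves independently and uniformly with \<open>n\<close> colours, and let
  \<open>Z k\<close> be the supremum of the waves of colour \<open>k\<close>. Averaging over the colours first turns the
  event \<open>\<forall>k. \<forall>p\<in>J k. Z k p \<le> a k p\<close>, for nonnegative thresholds, into a product as above, where \<open>\<Psi>\<close> is the arithmetic mean over \<open>k\<close> of the
  indicators of \<open>\<forall>p\<in>J k. x p \<le> a k p\<close>. The resulting probability \<open>\<Prod>k. exp (- V (J k) (a k) / n)\<close> shows at once
  that the \<open>Z k\<close> are independent, identically distributed, and that their maximum has the distribution
  function of \<open>\<eta>\<close>.
\<close>

section \<open>The function \<open>exp (- x)\<close> on \<open>[0, \<infinity>]\<close>\<close>

text \<open>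
  The value \<open>exp (- \<infinity>) = 0\<close> is included because the exponents that occur can be infinite: at the threshold
  \<open>0\<close> the waves that exceed it may have infinite intensity, and the distribution function is then \<open>0\<close>.
\<close>

definition expneg :: "ennreal \<Rightarrow> ennreal" where
  "expneg x = (if x = \<top> then 0 else ennreal (exp (- enn2real x)))"

lemma expneg_0 [simp]: "expneg 0 = 1"
  by (simp add: expneg_def)

lemma expneg_top [simp]: "expneg \<top> = 0"
  by (simp add: expneg_def)

lemma expneg_ennreal: "x \<ge> 0 \<Longrightarrow> expneg (ennreal x) = ennreal (exp (- x))"
  by (simp add: expneg_def)

lemma expneg_le_1: "expneg x \<le> 1"
  by (auto simp: expneg_def intro!: ennreal_leI[of _ 1, simplified])

lemma expneg_add: "expneg (x + y) = expneg x * expneg y"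
proof (cases "x = \<top> \<or> y = \<top>")
  case False
  then obtain a b where "x = ennreal a" "a \<ge> 0" "y = ennreal b" "b \<ge> 0"
    by (cases x; cases y) auto
  then show ?thesis
    by (simp add: expneg_ennreal flip: ennreal_plus ennreal_mult exp_add)
qed auto

lemma expneg_sum: "expneg (\<Sum>k\<in>K. f k) = (\<Prod>k\<in>K. expneg (f k))"
  by (induction K rule: infinite_finite_induct) (auto simp: expneg_add)

lemma expneg_power: "expneg x = expneg (x / of_nat n) ^ n" if "n \<ge> 1"
proof -
  have "x = (\<Sum>k<n. x / of_nat n)"
    using that by (simp add: ennreal_times_divide mult.commute[of "of_nat n"] ennreal_mult_divide_eq)
  then have "expneg x = expneg (\<Sum>k<n. x / of_nat n)" by simp
  then show ?thesis by (simp only: expneg_sum) simp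
qed

lemma tendsto_expneg:
  assumes "(f \<longlongrightarrow> x) G"
  shows "((\<lambda>i. expneg (f i)) \<longlongrightarrow> expneg x) G"
proof (cases "x = \<top>")
  case False
  then have "eventually (\<lambda>i. f i < \<top>) G"
    using assms by (intro order_tendstoD(2)) (auto simp: less_top)
  moreover have "((\<lambda>i. ennreal (exp (- enn2real (f i)))) \<longlongrightarrow> ennreal (exp (- enn2real x))) G"
    using False assms
    by (intro tendsto_ennrealI tendsto_exp tendsto_minus tendsto_enn2real) (auto simp: less_top)
  ultimately show ?thesis
    using False by (subst tendsto_cong[where g = "\<lambda>i. ennreal (exp (- enn2real (f i)))"])
      (auto simp: expneg_def elim: eventually_mono)
next
  case True
  have "eventually (\<lambda>i. expneg (f i) < e) G" if e: "e > 0" for e :: ennreal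
  proof -
    obtain d where d: "d > 0" "ennreal d < e"
    proof -
      obtain y where "0 < y" "y < e" using dense[OF e] by blast
      then show ?thesis by (cases y) (auto intro!: that)
    qed
    \<comment> \<open>Beyond \<open>\<bar>ln d\<bar>\<close> the exponential is below \<open>d\<close>.\<close>
    have "eventually (\<lambda>i. ennreal \<bar>ln d\<bar> < f i) G"
      using assms True by (intro order_tendstoD(1)) auto
    then show ?thesis
    proof (rule eventually_mono)
      fix i assume i: "ennreal \<bar>ln d\<bar> < f i"
      show "expneg (f i) < e"
      proof (cases "f i")
        case (real y)
        then have "- y < ln d" using i by (auto simp: ennreal_less_iff)
        then have "exp (- y) < d" using d by (metis exp_less_mono exp_ln)
        then have "ennreal (exp (- y)) \<le> ennreal d" by (intro ennreal_leI) simp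
        then show ?thesis using real le_less_trans[OF _ d(2)] by (auto simp: expneg_ennreal)
      qed (use e in auto)
    qed
  qed
  then show ?thesis using True by (auto intro!: order_tendstoI)
qed

section \<open>Infinite products of numbers in \<open>[0, 1]\<close>\<close>

lemma INF_decseq_eventually_const:
  fixes f :: "nat \<Rightarrow> 'a::complete_lattice"
  assumes "decseq f" "\<And>m. m \<ge> m0 \<Longrightarrow> f m = v"
  shows "(INF m. f m) = v"
proof (rule antisym)
  show "(INF m. f m) \<le> v" using assms(2)[of m0] by (metis INF_lower UNIV_I order_refl)
  show "v \<le> (INF m. f m)"
  proof (rule INF_greatest)
    fix m
    have "f (max m m0) \<le> f m" using assms(1) by (auto simp: decseq_def)
    then show "v \<le> f m" using assms(2)[of "max m m0"] by simp
  qed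
qed

lemma decseq_prod_le_1:
  fixes f :: "nat \<Rightarrow> ennreal"
  assumes "\<And>i. f i \<le> 1"
  shows "decseq (\<lambda>m. \<Prod>i<m. f i)"
  using assms by (intro decseq_SucI) (auto intro: order_trans[OF mult_left_mono[of _ 1]])

lemma prod_le_1_ennreal: "(\<And>i. i \<in> K \<Longrightarrow> f i \<le> (1 :: ennreal)) \<Longrightarrow> (\<Prod>i\<in>K. f i) \<le> 1"
  by (induction K rule: infinite_finite_induct) (auto intro: order_trans[OF mult_mono[of _ 1 _ 1]])

lemma prod_mono_ennreal:
  "(\<And>i. i \<in> K \<Longrightarrow> f i \<le> (g i :: ennreal)) \<Longrightarrow> (\<Prod>i\<in>K. f i) \<le> (\<Prod>i\<in>K. g i)"
  by (induction K rule: infinite_finite_induct) (auto intro: mult_mono)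

text \<open>
  Multiplication on \<open>ennreal\<close> is discontinuous at \<open>(0, \<infinity>)\<close>; limits bounded by \<open>1\<close> keep away from that point.
\<close>

lemma tendsto_prod_le_1:
  fixes f :: "'i \<Rightarrow> 'a \<Rightarrow> ennreal"
  assumes "\<And>i. i \<in> K \<Longrightarrow> (f i \<longlongrightarrow> g i) G" "\<And>i. i \<in> K \<Longrightarrow> g i \<le> 1"
  shows "((\<lambda>x. \<Prod>i\<in>K. f i x) \<longlongrightarrow> (\<Prod>i\<in>K. g i)) G"
  using assms
proof (induction K rule: infinite_finite_induct)
  case (insert i K)
  have "g i < \<infinity>" "(\<Prod>j\<in>K. g j) < \<infinity>"
    using insert.prems(2) prod_le_1_ennreal[of K g]
    by (auto simp: less_top intro: le_less_trans[of _ 1])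
  then show ?case
    using insert by (auto intro!: tendsto_mult_ennreal)
qed auto

lemma nn_integral_INF_prod:
  fixes f :: "nat \<Rightarrow> 'a \<Rightarrow> ennreal"
  assumes "prob_space M" "\<And>i. f i \<in> borel_measurable M" "\<And>i \<omega>. f i \<omega> \<le> 1"
  shows "(\<integral>\<^sup>+ \<omega>. (INF m. \<Prod>i<m. f i \<omega>) \<partial>M) = (INF m. \<integral>\<^sup>+ \<omega>. (\<Prod>i<m. f i \<omega>) \<partial>M)"
proof (rule nn_integral_monotone_convergence_INF_decseq[where f = "\<lambda>m \<omega>. \<Prod>i<m. f i \<omega>"])
  interpret prob_space M by fact
  show "decseq (\<lambda>m \<omega>. \<Prod>i<m. f i \<omega>)"
  proof (intro decseq_SucI le_funI)
    fix m \<omega>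
    show "(\<Prod>i<Suc m. f i \<omega>) \<le> (\<Prod>i<m. f i \<omega>)"
      using decseq_prod_le_1[of "\<lambda>i. f i \<omega>", OF assms(3)] by (rule decseq_SucD)
  qed
  show "(\<integral>\<^sup>+ \<omega>. (\<Prod>i<m. f i \<omega>) \<partial>M) < \<infinity>" for m
  proof -
    have "(\<integral>\<^sup>+ \<omega>. (\<Prod>i<m. f i \<omega>) \<partial>M) \<le> (\<integral>\<^sup>+ \<omega>. 1 \<partial>M)"
      using assms(3) by (intro nn_integral_mono prod_le_1_ennreal) auto
    then show ?thesis by (simp add: emeasure_space_1 order_le_less_trans)
  qed
qed (use assms in measurable)

lemma INF_prod_indicator:
  "(INF m. \<Prod>i<m. indicator B (x i) :: ennreal) = (if \<forall>i::nat. x i \<in> B then 1 else 0)"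
proof (cases "\<forall>i. x i \<in> B")
  case False
  then obtain i where i: "x i \<notin> B" by auto
  then have "(\<Prod>i<Suc i. indicator B (x i) :: ennreal) = 0" by simp
  then have "(INF m. \<Prod>i<m. indicator B (x i) :: ennreal) \<le> 0" by (intro INF_lower2[of "Suc i"]) auto
  then show ?thesis using False by auto
qed simp

text \<open>
  Infinitely many factors \<open>z < 1\<close> make the product smaller than every power of \<open>z\<close>.
\<close>

lemma INF_prod_infinitely_often:
  fixes z :: real
  assumes S: "infinite S" and z: "0 \<le> z" "z < 1"
  shows "(INF m::nat. \<Prod>i<m. if i \<in> S then ennreal z else 1) = 0"
proof -
  have "(INF m. \<Prod>i<m. if i \<in> S then ennreal z else 1) \<le> ennreal (z ^ j)" for j
  proof -
    obtain K where K: "K \<subseteq> S" "finite K" "card K = j"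
      using infinite_arbitrarily_large[OF S] by metis
    then obtain m where m: "K \<subseteq> {..<m}" by (metis finite_nat_iff_bounded)
    have "(\<Prod>i<m. if i \<in> S then ennreal z else 1) = (\<Prod>i\<in>{..<m} \<inter> S. ennreal z)"
      by (subst prod.inter_restrict) auto
    also have "\<dots> = ennreal (z ^ card ({..<m} \<inter> S))" using z by (simp add: ennreal_power)
    also have "\<dots> \<le> ennreal (z ^ j)"
      using z K m by (intro ennreal_leI power_decreasing) (auto intro: card_mono)
    finally show ?thesis by (rule INF_lower2[rotated]) simp
  qed
  moreover have "(\<lambda>j. ennreal (z ^ j)) \<longlonglongrightarrow> ennreal 0"
    using z by (intro tendsto_ennrealI LIMSEQ_power_zero) auto
  ultimately have "(INF m. \<Prod>i<m. if i \<in> S then ennreal z else 1) \<le> ennreal 0"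
    by (intro LIMSEQ_le_const) auto
  then show ?thesis by simp
qed

section \<open>The Laplace functional of a Poisson point process\<close>

text \<open>
  A finite count means that only finitely many points lie in \<open>B\<close>, so from some index on no further factor
  \<open>z\<close> occurs.
\<close>

lemma eventually_prod_eq_power:
  fixes x :: "nat \<Rightarrow> 's" and z :: ennreal
  assumes "(\<Sum>i. indicator B (x i) :: ennreal) = of_nat j"
  obtains m0 where "\<And>m. m \<ge> m0 \<Longrightarrow> (\<Prod>i<m. if x i \<in> B then z else 1) = z ^ j"
proof -
  define S where "S = {i. x i \<in> B}"
  have "(\<Sum>i. indicator B (x i) :: ennreal) = (\<Sum>i. indicator S i)"
    by (rule arg_cong[where f = suminf]) (auto simp: S_def indicator_def)
  also have "\<dots> = emeasure (count_space UNIV) S"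
    by (subst nn_integral_count_space_nat[symmetric]) simp
  finally have S: "finite S" "card S = j"
    using assms by (auto simp: emeasure_count_space split: if_splits)
  from S(1) obtain m0 where m0: "S \<subseteq> {..<m0}"
    by (metis finite_nat_iff_bounded)
  show thesis
  proof (rule that)
    fix m assume "m \<ge> m0"
    then have "S = {..<m} \<inter> S" using m0 by auto
    then have "card ({..<m} \<inter> S) = j" using S by metis
    moreover have "(\<Prod>i<m. if x i \<in> B then z else 1) = (\<Prod>i\<in>{..<m} \<inter> S. z)"
      by (subst prod.inter_restrict) (auto simp: S_def)
    ultimately show "(\<Prod>i<m. if x i \<in> B then z else 1) = z ^ j"
      by simp
  qed
qed

text \<open>
  The power \<open>z ^ c\<close> of a point count \<open>c\<close>, which has type \<open>ennreal\<close>. It is applied to counts that are almost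
  surely finite; at \<open>c = \<infinity>\<close> it takes the value \<open>1\<close>, since \<open>enn2real \<infinity> = 0\<close>.
\<close>

definition count_power :: "real \<Rightarrow> ennreal \<Rightarrow> ennreal" where
  "count_power z c = ennreal (z ^ nat \<lfloor>enn2real c\<rfloor>)"

lemma count_power_of_nat [simp]: "count_power z (of_nat j) = ennreal (z ^ j)"
  by (simp add: count_power_def)

lemma measurable_count_power [measurable]: "count_power z \<in> borel_measurable borel"
  unfolding count_power_def by measurable

lemma measurable_point_count:
  assumes "\<And>i. X i \<in> measurable M S" "B \<in> sets S"
  shows "point_count X B \<in> borel_measurable M"
  unfolding point_count_def using assms by measurable

text \<open>
  The Poisson weights sum to \<open>1\<close>, which leaves no mass for other values of the count, in particular not
  for \<open>\<infinity>\<close>. Weighted with \<open>z ^ k\<close> they sum to the generating function.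
\<close>

lemma poisson_count_generating_function:
  assumes ppp: "poisson_point_process M \<mu> X" and B: "B \<in> sets \<mu>" "emeasure \<mu> B < \<infinity>"
    and z: "0 \<le> z" "z \<le> 1"
  shows "(\<integral>\<^sup>+ \<omega>. count_power z (point_count X B \<omega>) \<partial>M) = ennreal (exp (- ((1 - z) * measure \<mu> B)))"
    and "AE \<omega> in M. \<exists>j. point_count X B \<omega> = of_nat j"
proof -
  interpret prob_space M using ppp by (simp add: poisson_point_process_def)
  have [measurable]: "point_count X B \<in> borel_measurable M"
    using ppp B by (intro measurable_point_count) (auto simp: poisson_point_process_def)
  let ?m = "measure \<mu> B"
  have emP: "emeasure M {\<omega>\<in>space M. point_count X B \<omega> = of_nat k} = ennreal (exp (- ?m) * ?m ^ k / fact k)" for k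
    using ppp B by (simp add: poisson_point_process_def emeasure_eq_measure)
  have s: "(\<lambda>k. exp (- ?m) * (w * ?m) ^ k / fact k) sums exp (- ((1 - w) * ?m))" for w
  proof -
    have "(\<lambda>k. exp (- ?m) * ((w * ?m) ^ k /\<^sub>R fact k)) sums (exp (- ?m) * exp (w * ?m))"
      by (intro sums_mult exp_converges)
    also have "exp (- ?m) * exp (w * ?m) = exp (- ((1 - w) * ?m))"
      by (simp add: algebra_simps flip: exp_add)
    finally show ?thesis by (simp add: field_simps)
  qed
  have suminf_pois: "(\<Sum>k. ennreal (w ^ k) * ennreal (exp (- ?m) * ?m ^ k / fact k)) = ennreal (exp (- ((1 - w) * ?m)))"
    if w: "w \<ge> 0" for w
  proof -
    have "ennreal (w ^ k) * ennreal (exp (- ?m) * ?m ^ k / fact k) = ennreal (exp (- ?m) * (w * ?m) ^ k / fact k)" for k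
      using w by (simp add: power_mult_distrib field_simps flip: ennreal_mult')
    then show ?thesis
      using w s[of w] by (intro trans[OF arg_cong[where f=suminf] suminf_ennreal_eq]) (auto simp: fun_eq_iff)
  qed
  have decomp: "(\<integral>\<^sup>+ \<omega>. (\<Sum>k. ennreal (w ^ k) * indicator {\<omega>\<in>space M. point_count X B \<omega> = of_nat k} \<omega>) \<partial>M)
    = ennreal (exp (- ((1 - w) * ?m)))" if w: "w \<ge> 0" for w
    by (subst nn_integral_suminf) (simp_all add: nn_integral_cmult_indicator emP suminf_pois[OF w])
  have disj: "disjoint_family (\<lambda>k::nat. {\<omega>\<in>space M. point_count X B \<omega> = of_nat k})"
    by (auto simp: disjoint_family_on_def)
  have "emeasure M (\<Union>k. {\<omega>\<in>space M. point_count X B \<omega> = of_nat k}) =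
      (\<Sum>k. emeasure M {\<omega>\<in>space M. point_count X B \<omega> = of_nat k})"
    by (rule suminf_emeasure[symmetric]) (use disj in auto)
  also have "\<dots> = (\<Sum>k. ennreal (1 ^ k) * ennreal (exp (- ?m) * ?m ^ k / fact k))"
    by (simp only: emP power_one ennreal_1 mult_1_left)
  also have "\<dots> = 1"
    by (subst suminf_pois) auto
  also have "(\<Union>k. {\<omega>\<in>space M. point_count X B \<omega> = of_nat k}) =
      {\<omega>\<in>space M. \<exists>k. point_count X B \<omega> = of_nat k}" by auto
  finally have "prob {\<omega>\<in>space M. \<exists>k. point_count X B \<omega> = of_nat k} = 1"
    by (simp add: emeasure_eq_measure)
  then show AE: "AE \<omega> in M. \<exists>j. point_count X B \<omega> = of_nat j"
    by (subst (asm) prob_Collect_eq_1) auto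
  have "(\<integral>\<^sup>+ \<omega>. count_power z (point_count X B \<omega>) \<partial>M) =
    (\<integral>\<^sup>+ \<omega>. (\<Sum>k. ennreal (z ^ k) * indicator {\<omega>\<in>space M. point_count X B \<omega> = of_nat k} \<omega>) \<partial>M)"
  proof (rule nn_integral_cong_AE, use AE AE_space in eventually_elim, elim exE)
    fix \<omega> j assume \<omega>: "\<omega> \<in> space M" and j: "point_count X B \<omega> = of_nat j"
    show "count_power z (point_count X B \<omega>) = (\<Sum>k. ennreal (z ^ k) * indicator {\<omega>\<in>space M. point_count X B \<omega> = of_nat k} \<omega>)"
    proof (subst suminf_finite[of "{j}"])
      fix k assume "k \<notin> {j}"
      then show "ennreal (z ^ k) * indicator {\<omega>\<in>space M. point_count X B \<omega> = of_nat k} \<omega> = 0"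
        using j by (auto simp: indicator_def)
    qed (use j \<omega> in auto)
  qed
  then show "(\<integral>\<^sup>+ \<omega>. count_power z (point_count X B \<omega>) \<partial>M) = ennreal (exp (- ((1 - z) * ?m)))"
    by (simp add: decomp[OF z(1)])
qed

text \<open>
  Almost surely every \<open>B k\<close> contains finitely many points. Then the product over the points can be
  regrouped as the product over \<open>k\<close> of \<open>(1 - c k)\<close> to the power of the number of points in \<open>B k\<close>. These
  numbers are independent since the \<open>B k\<close> are disjoint.
\<close>

lemma poisson_laplace_simple:
  fixes B :: "nat \<Rightarrow> 's set" and c :: "nat \<Rightarrow> real"
  assumes ppp: "poisson_point_process M \<mu> X"
    and B: "\<And>k. k < n \<Longrightarrow> B k \<in> sets \<mu>" "\<And>k. k < n \<Longrightarrow> emeasure \<mu> (B k) < \<infinity>"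
    and disj: "disjoint_family_on B {..<n}"
    and c: "\<And>k. k < n \<Longrightarrow> 0 \<le> c k" "\<And>k. k < n \<Longrightarrow> c k \<le> 1"
  shows "(\<integral>\<^sup>+ \<omega>. (INF m. \<Prod>i<m. \<Prod>k<n. if X i \<omega> \<in> B k then ennreal (1 - c k) else 1) \<partial>M)
      = expneg (\<Sum>k<n. ennreal (c k) * emeasure \<mu> (B k))"
proof -
  interpret prob_space M using ppp by (simp add: poisson_point_process_def)
  let ?N = "\<lambda>k. point_count X (B k)"
  let ?f = "\<lambda>x. \<Prod>k<n. if x \<in> B k then ennreal (1 - c k) else 1"
  have le1: "?f x \<le> 1" for x
    using c by (intro prod_le_1_ennreal) auto
  have "AE \<omega> in M. \<forall>k\<in>{..<n}. \<exists>j. ?N k \<omega> = of_nat j"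
    using poisson_count_generating_function(2)[OF ppp B, of _ 1] by (intro AE_finite_allI) auto
  then have "(\<integral>\<^sup>+ \<omega>. (INF m. \<Prod>i<m. ?f (X i \<omega>)) \<partial>M) = (\<integral>\<^sup>+ \<omega>. (\<Prod>k<n. count_power (1 - c k) (?N k \<omega>)) \<partial>M)"
  proof (intro nn_integral_cong_AE, eventually_elim)
    fix \<omega> assume "\<forall>k\<in>{..<n}. \<exists>j. ?N k \<omega> = of_nat j"
    then obtain j where j: "\<And>k. k < n \<Longrightarrow> ?N k \<omega> = of_nat (j k)"
      by (auto simp: Ball_def) metis
    have "\<exists>m0. \<forall>m\<ge>m0. (\<Prod>i<m. if X i \<omega> \<in> B k then ennreal (1 - c k) else 1) = ennreal (1 - c k) ^ j k"
      if "k < n" for k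
      using eventually_prod_eq_power[of "B k" "\<lambda>i. X i \<omega>" "j k" "ennreal (1 - c k)"] j[OF that]
      unfolding point_count_def by metis
    then obtain m0 where m0: "\<And>k m. k < n \<Longrightarrow> m \<ge> m0 k \<Longrightarrow>
        (\<Prod>i<m. if X i \<omega> \<in> B k then ennreal (1 - c k) else 1) = ennreal (1 - c k) ^ j k"
      by metis
    show "(INF m. \<Prod>i<m. ?f (X i \<omega>)) = (\<Prod>k<n. count_power (1 - c k) (?N k \<omega>))"
    proof (rule INF_decseq_eventually_const)
      show "decseq (\<lambda>m. \<Prod>i<m. ?f (X i \<omega>))"
        using le1 by (rule decseq_prod_le_1)
      fix m assume "m \<ge> (\<Sum>k<n. m0 k)"
      then have "m \<ge> m0 k" if "k < n" for k
        using member_le_sum[of k "{..<n}" m0] that by auto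
      then have "(\<Prod>k<n. \<Prod>i<m. if X i \<omega> \<in> B k then ennreal (1 - c k) else 1) = (\<Prod>k<n. ennreal (1 - c k) ^ j k)"
        using m0 by (intro prod.cong) auto
      also have "\<dots> = (\<Prod>k<n. count_power (1 - c k) (?N k \<omega>))"
        using j c by (intro prod.cong) (auto simp: ennreal_power)
      finally show "(\<Prod>i<m. ?f (X i \<omega>)) = (\<Prod>k<n. count_power (1 - c k) (?N k \<omega>))"
        by (subst prod.swap)
    qed
  qed
  also have "\<dots> = (\<Prod>k<n. \<integral>\<^sup>+ \<omega>. count_power (1 - c k) (?N k \<omega>) \<partial>M)"
  proof (rule indep_vars_nn_integral)
    have "B ` {..<n} \<subseteq> sets \<mu> \<and> disjoint_family_on B {..<n}"
      using B disj by auto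
    then have "indep_vars (\<lambda>_. borel) ?N {..<n}"
      using ppp unfolding poisson_point_process_def by blast
    then show "indep_vars (\<lambda>_. borel) (\<lambda>k \<omega>. count_power (1 - c k) (?N k \<omega>)) {..<n}"
      by (rule indep_vars_compose2) simp
  qed auto
  also have "\<dots> = (\<Prod>k<n. expneg (ennreal (c k) * emeasure \<mu> (B k)))"
  proof (rule prod.cong)
    fix k assume "k \<in> {..<n}"
    then have k: "k < n" by simp
    have "emeasure \<mu> (B k) = ennreal (measure \<mu> (B k))"
      using B(2)[OF k] by (simp add: emeasure_eq_ennreal_measure less_top)
    then show "(\<integral>\<^sup>+ \<omega>. count_power (1 - c k) (?N k \<omega>) \<partial>M) = expneg (ennreal (c k) * emeasure \<mu> (B k))"
      using poisson_count_generating_function(1)[OF ppp B[OF k], of "1 - c k"] c[OF k]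
      by (simp add: expneg_ennreal flip: ennreal_mult')
  qed simp
  finally show ?thesis by (simp add: expneg_sum)
qed

text \<open>
  The nonzero level sets of \<open>p\<close> are disjoint and of finite measure, so they can serve as the \<open>B k\<close>. They are
  enumerated by \<open>nat\<close>, the index type of the sets in the definition of a Poisson point process.
\<close>

lemma poisson_laplace_finite_support:
  assumes ppp: "poisson_point_process M \<mu> X"
    and p: "simple_function \<mu> p" "\<And>s. p s \<le> 1"
    and fin: "emeasure \<mu> {s \<in> space \<mu>. p s \<noteq> 0} < \<infinity>"
  shows "(\<integral>\<^sup>+ \<omega>. (INF m. \<Prod>i<m. 1 - p (X i \<omega>)) \<partial>M) = expneg (\<integral>\<^sup>+ s. p s \<partial>\<mu>)"
proof -
  define C where "C = p ` space \<mu> - {0}"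
  have finC: "finite C" using p(1) by (auto simp: C_def simple_function_def)
  obtain h where h: "bij_betw h {..<card C} C"
    using ex_bij_betw_nat_finite[OF finC] by (auto simp: atLeast0LessThan)
  define B where "B k = {s \<in> space \<mu>. p s = h k}" for k
  define c where "c k = enn2real (h k)" for k
  have [measurable]: "p \<in> borel_measurable \<mu>" using p(1) by (rule borel_measurable_simple_function)
  have hC: "h k \<in> C" if "k < card C" for k
    using h that by (auto dest: bij_betwE)
  have h1: "h k \<le> 1" "h k \<noteq> 0" if "k < card C" for k
    using hC[OF that] p(2) by (auto simp: C_def)
  have hc: "h k = ennreal (c k)" if "k < card C" for k
    using h1[OF that] unfolding c_def by (subst ennreal_enn2real) (auto simp: less_top intro: le_less_trans[of _ 1])
  have c01: "0 \<le> c k" "c k \<le> 1" if "k < card C" for k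
  proof -
    have "ennreal (c k) \<le> 1" using h1[OF that] hc[OF that] by simp
    then show "c k \<le> 1" by simp
  qed (simp add: c_def)
  have Bsets: "B k \<in> sets \<mu>" for k unfolding B_def by measurable
  have "emeasure \<mu> (B k) \<le> emeasure \<mu> {s \<in> space \<mu>. p s \<noteq> 0}" if "k < card C" for k
    using h1[OF that] by (intro emeasure_mono) (auto simp: B_def)
  then have Bfin: "emeasure \<mu> (B k) < \<infinity>" if "k < card C" for k
    using fin that by (auto intro: le_less_trans)
  have disj: "disjoint_family_on B {..<card C}"
    using bij_betw_imp_inj_on[OF h] by (auto simp: disjoint_family_on_def B_def inj_on_def)
  have f: "1 - p s = (\<Prod>k<card C. if s \<in> B k then ennreal (1 - c k) else 1)" if s: "s \<in> space \<mu>" for s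
  proof (cases "p s = 0")
    case True
    then have "s \<notin> B k" if "k < card C" for k using h1[OF that] by (auto simp: B_def)
    then show ?thesis using True by simp
  next
    case False
    then have "p s \<in> C" using s by (auto simp: C_def)
    then obtain k0 where k0: "k0 < card C" "p s = h k0"
      using h by (auto simp: bij_betw_def image_iff)
    have "s \<in> B k \<longleftrightarrow> k = k0" if "k < card C" for k
      using bij_betw_imp_inj_on[OF h] k0 that s by (auto simp: B_def inj_on_def)
    then have "(\<Prod>k<card C. if s \<in> B k then ennreal (1 - c k) else 1) = (\<Prod>k<card C. if k = k0 then ennreal (1 - c k) else 1)"
      by (intro prod.cong) auto
    also have "\<dots> = ennreal (1 - c k0)" using k0(1) by simp
    also have "\<dots> = 1 - p s"
      using k0 hc[OF k0(1)] c01[OF k0(1)] by (simp add: ennreal_minus flip: ennreal_1)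
    finally show ?thesis by simp
  qed
  have Xsp: "X i \<omega> \<in> space \<mu>" if "\<omega> \<in> space M" for i \<omega>
    using ppp that by (auto simp: poisson_point_process_def dest: measurable_space)
  have "(\<integral>\<^sup>+ \<omega>. (INF m. \<Prod>i<m. 1 - p (X i \<omega>)) \<partial>M)
      = (\<integral>\<^sup>+ \<omega>. (INF m. \<Prod>i<m. \<Prod>k<card C. if X i \<omega> \<in> B k then ennreal (1 - c k) else 1) \<partial>M)"
    by (intro nn_integral_cong) (simp only: f Xsp)
  also have "\<dots> = expneg (\<Sum>k<card C. ennreal (c k) * emeasure \<mu> (B k))"
    by (rule poisson_laplace_simple[OF ppp]) (use Bsets Bfin disj c01 in auto)
  also have "(\<Sum>k<card C. ennreal (c k) * emeasure \<mu> (B k)) = (\<Sum>k<card C. h k * emeasure \<mu> (p -` {h k} \<inter> space \<mu>))"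
    by (intro sum.cong) (auto simp: hc B_def intro!: arg_cong[where f = "\<lambda>x. _ * emeasure \<mu> x"])
  also have "\<dots> = (\<Sum>x\<in>C. x * emeasure \<mu> (p -` {x} \<inter> space \<mu>))"
    by (rule sum.reindex_bij_betw[OF h])
  also have "\<dots> = (\<Sum>x\<in>p ` space \<mu>. x * emeasure \<mu> (p -` {x} \<inter> space \<mu>))"
    using p(1) by (intro sum.mono_neutral_left) (auto simp: C_def simple_function_def)
  also have "\<dots> = (\<integral>\<^sup>+ s. p s \<partial>\<mu>)"
    using p(1) by (simp add: nn_integral_eq_simple_integral simple_integral_def)
  finally show ?thesis .
qed

text \<open>
  By \<open>\<sigma>\<close>-finiteness \<open>1 - f\<close> is the increasing limit of simple functions \<open>p m\<close> with support of finite measure.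
  The products of the factors \<open>1 - p m\<close> decrease to those of the factors \<open>f\<close>, because the infimum over \<open>m\<close> commutes
  with the infimum that encodes the infinite product.
\<close>

theorem poisson_laplace:
  fixes f :: "'s \<Rightarrow> ennreal"
  assumes ppp: "poisson_point_process M \<mu> X" and sf: "sigma_finite_measure \<mu>"
    and f[measurable]: "f \<in> borel_measurable \<mu>" and f1: "\<And>s. f s \<le> 1"
  shows "(\<integral>\<^sup>+ \<omega>. (INF m. \<Prod>i<m. f (X i \<omega>)) \<partial>M) = expneg (\<integral>\<^sup>+ s. 1 - f s \<partial>\<mu>)"
proof -
  interpret prob_space M using ppp by (simp add: poisson_point_process_def)
  interpret \<mu>: sigma_finite_measure \<mu> by (rule sf)
  have X[measurable]: "X i \<in> measurable M \<mu>" for i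
    using ppp by (simp add: poisson_point_process_def)
  obtain A :: "nat \<Rightarrow> 's set" where A: "range A \<subseteq> sets \<mu>" "(\<Union>i. A i) = space \<mu>"
    "\<And>i. emeasure \<mu> (A i) \<noteq> \<infinity>" "incseq A"
    using \<mu>.sigma_finite_incseq by metis
  obtain U where U: "\<And>i. simple_function \<mu> (U i)" "incseq U" "\<And>s. (SUP i. U i s) = 1 - f s"
  proof -
    have "(\<lambda>s. 1 - f s) \<in> borel_measurable \<mu>" by measurable
    from borel_measurable_implies_simple_function_sequence'[OF this] that show thesis by metis
  qed
  define p where "p m s = U m s * indicator (A m) s" for m s
  have p_simple: "simple_function \<mu> (p m)" for m
    unfolding p_def using A(1) U(1) by (intro simple_function_mult simple_function_indicator) auto
  have [measurable]: "p m \<in> borel_measurable \<mu>" for m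
    by (rule borel_measurable_simple_function[OF p_simple])
  have U1: "U m s \<le> 1 - f s" for m s
    unfolding U(3)[symmetric] by (rule SUP_upper) simp
  have p1: "p m s \<le> 1" for m s
    using U1[of m s] by (auto simp: p_def indicator_def intro: order_trans)
  have incp: "incseq (\<lambda>m. p m s)" for s
    using U(2) A(4) by (fastforce simp: incseq_def le_fun_def p_def indicator_def)
  have SUPp: "(SUP m. p m s) = 1 - f s" if s: "s \<in> space \<mu>" for s
  proof (rule antisym)
    show "(SUP m. p m s) \<le> 1 - f s"
      using U1 by (intro SUP_least) (auto simp: p_def indicator_def)
    obtain k where k: "s \<in> A k" using A(2) s by auto
    show "1 - f s \<le> (SUP m. p m s)"
      unfolding U(3)[symmetric]
    proof (rule SUP_least)
      fix m
      have "U m s \<le> U (max m k) s" using U(2) by (auto simp: incseq_def le_fun_def)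
      also have "\<dots> = p (max m k) s"
        using k incseqD[OF A(4), of k "max m k"] by (auto simp: p_def)
      also have "\<dots> \<le> (SUP m. p m s)" by (rule SUP_upper) simp
      finally show "U m s \<le> (SUP m. p m s)" .
    qed
  qed
  have fin: "emeasure \<mu> {s \<in> space \<mu>. p m s \<noteq> 0} < \<infinity>" for m
  proof -
    have "emeasure \<mu> {s \<in> space \<mu>. p m s \<noteq> 0} \<le> emeasure \<mu> (A m)"
      using A(1) by (intro emeasure_mono) (auto simp: p_def indicator_def split: if_splits)
    then show ?thesis using A(3)[of m] by (auto simp: less_top intro: le_less_trans)
  qed
  have approx: "(\<integral>\<^sup>+ \<omega>. (INF k. \<Prod>i<k. 1 - p m (X i \<omega>)) \<partial>M) = expneg (\<integral>\<^sup>+ s. p m s \<partial>\<mu>)" for m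
    by (rule poisson_laplace_finite_support[OF ppp p_simple p1 fin])
  have dec: "decseq (\<lambda>m. 1 - p m s)" for s
    using incp[of s] by (auto simp: decseq_def incseq_def intro: ennreal_minus_mono)
  have INFp: "(INF m. 1 - p m s) = f s" if "s \<in> space \<mu>" for s
    by (subst ennreal_SUP_const_minus) (auto simp: SUPp[OF that] diff_diff_ennreal f1)
  have INFprod: "(INF m. \<Prod>i<k. 1 - p m (X i \<omega>)) = (\<Prod>i<k. f (X i \<omega>))" if "\<omega> \<in> space M" for \<omega> k
  proof (rule LIMSEQ_unique)
    show "(\<lambda>m. \<Prod>i<k. 1 - p m (X i \<omega>)) \<longlonglongrightarrow> (INF m. \<Prod>i<k. 1 - p m (X i \<omega>))"
      using dec by (intro LIMSEQ_INF) (auto simp: decseq_def intro!: prod_mono_ennreal)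
    show "(\<lambda>m. \<Prod>i<k. 1 - p m (X i \<omega>)) \<longlonglongrightarrow> (\<Prod>i<k. f (X i \<omega>))"
    proof (rule tendsto_prod_le_1)
      fix i
      have "X i \<omega> \<in> space \<mu>" using X that by (rule measurable_space)
      then show "(\<lambda>m. 1 - p m (X i \<omega>)) \<longlonglongrightarrow> f (X i \<omega>)"
        using LIMSEQ_INF[OF dec, of "X i \<omega>"] by (simp add: INFp)
    qed (rule f1)
  qed
  have mono: "decseq (\<lambda>m \<omega>. INF k. \<Prod>i<k. 1 - p m (X i \<omega>))"
    by (intro decseq_SucI le_funI INF_mono' prod_mono_ennreal decseq_SucD[OF dec])
  have "(\<integral>\<^sup>+ \<omega>. (INF m. \<Prod>i<m. f (X i \<omega>)) \<partial>M) = (\<integral>\<^sup>+ \<omega>. (INF k. INF m. \<Prod>i<k. 1 - p m (X i \<omega>)) \<partial>M)"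
    by (intro nn_integral_cong) (simp add: INFprod)
  also have "\<dots> = (\<integral>\<^sup>+ \<omega>. (INF m. INF k. \<Prod>i<k. 1 - p m (X i \<omega>)) \<partial>M)"
    by (subst INF_commute) (rule refl)
  also have "\<dots> = (INF m. \<integral>\<^sup>+ \<omega>. (INF k. \<Prod>i<k. 1 - p m (X i \<omega>)) \<partial>M)"
  proof (rule nn_integral_monotone_convergence_INF_decseq[OF mono])
    show "(\<integral>\<^sup>+ \<omega>. (INF k. \<Prod>i<k. 1 - p m (X i \<omega>)) \<partial>M) < \<infinity>" for m
      unfolding approx by (rule le_less_trans[OF expneg_le_1]) simp
  qed measurable
  also have "\<dots> = expneg (\<integral>\<^sup>+ s. 1 - f s \<partial>\<mu>)"
  proof (rule LIMSEQ_unique)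
    show "(\<lambda>m. \<integral>\<^sup>+ \<omega>. (INF k. \<Prod>i<k. 1 - p m (X i \<omega>)) \<partial>M) \<longlonglongrightarrow> (INF m. \<integral>\<^sup>+ \<omega>. (INF k. \<Prod>i<k. 1 - p m (X i \<omega>)) \<partial>M)"
      by (intro LIMSEQ_INF decseq_SucI nn_integral_mono le_funD[OF decseq_SucD[OF mono]])
    have "(\<lambda>m. \<integral>\<^sup>+ s. p m s \<partial>\<mu>) \<longlonglongrightarrow> (SUP m. \<integral>\<^sup>+ s. p m s \<partial>\<mu>)"
      using incp by (intro LIMSEQ_SUP) (auto simp: incseq_def intro!: nn_integral_mono)
    also have "(SUP m. \<integral>\<^sup>+ s. p m s \<partial>\<mu>) = (\<integral>\<^sup>+ s. (SUP m. p m s) \<partial>\<mu>)"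
      using incp by (intro nn_integral_monotone_convergence_SUP[symmetric]) (auto simp: incseq_def le_fun_def)
    also have "\<dots> = (\<integral>\<^sup>+ s. 1 - f s \<partial>\<mu>)"
      by (intro nn_integral_cong SUPp)
    finally show "(\<lambda>m. \<integral>\<^sup>+ \<omega>. (INF k. \<Prod>i<k. 1 - p m (X i \<omega>)) \<partial>M) \<longlonglongrightarrow> expneg (\<integral>\<^sup>+ s. 1 - f s \<partial>\<mu>)"
      unfolding approx by (rule tendsto_expneg)
  qed
  finally show ?thesis .
qed

section \<open>Independent marks\<close>

lemma measurable_supalgebra:
  assumes "f \<in> measurable G N" "space G = space M" "sets G \<subseteq> sets M"
  shows "f \<in> measurable M N"
  using assms measurable_mono[of N N G M] by auto

text \<open>
  Independence of \<open>G\<close> and \<open>H\<close> means that the identity maps from \<open>M\<close> to \<open>G\<close> and to \<open>H\<close> are independent, that is,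
  the image of \<open>M\<close> under the diagonal map to \<open>G \<Otimes> H\<close> is the product measure.
\<close>

lemma (in prob_space) nn_integral_indep_subalgebras:
  assumes indep: "indep_set (sets G) (sets H)"
    and space: "space G = space M" "space H = space M"
    and f: "f \<in> borel_measurable (G \<Otimes>\<^sub>M H)"
  shows "(\<integral>\<^sup>+ \<omega>. f (\<omega>, \<omega>) \<partial>M) = (\<integral>\<^sup>+ \<omega>. \<integral>\<^sup>+ \<omega>'. f (\<omega>, \<omega>') \<partial>M \<partial>M)"
proof -
  have sub: "sets G \<subseteq> events" "sets H \<subseteq> events"
    using indep_setD_ev1[OF indep] indep_setD_ev2[OF indep] by auto
  have id [measurable]: "(\<lambda>x. x) \<in> measurable M G" "(\<lambda>x. x) \<in> measurable M H"
    using sub space by (auto intro!: measurable_supalgebra[OF measurable_ident_sets])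
  have gen: "sigma_sets (space M) {(\<lambda>x. x) -` A \<inter> space M |A. A \<in> sets K} = sets K" if "space K = space M" for K
  proof -
    have "{(\<lambda>x. x) -` A \<inter> space M |A. A \<in> sets K} = (\<lambda>A. A \<inter> space K) ` sets K"
      using that by auto
    also have "\<dots> = (\<lambda>A. A) ` sets K"
      by (intro image_cong) (auto dest: sets.sets_into_space)
    finally have "{(\<lambda>x. x) -` A \<inter> space M |A. A \<in> sets K} = sets K" by simp
    then show ?thesis using sets.sigma_sets_eq[of K] that by simp
  qed
  have "indep_var G (\<lambda>x. x) H (\<lambda>x. x)"
    unfolding indep_var_eq gen[OF space(1)] gen[OF space(2)] using id indep by blast
  then have distr: "distr M G (\<lambda>x. x) \<Otimes>\<^sub>M distr M H (\<lambda>x. x) = distr M (G \<Otimes>\<^sub>M H) (\<lambda>x. (x, x))"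
    by (simp add: indep_var_distribution_eq)
  interpret H: prob_space "distr M H (\<lambda>x. x)" by (rule prob_space_distr[OF id(2)])
  have "(\<integral>\<^sup>+ \<omega>. f (\<omega>, \<omega>) \<partial>M) = (\<integral>\<^sup>+ x. f x \<partial>distr M (G \<Otimes>\<^sub>M H) (\<lambda>x. (x, x)))"
    using f by (subst nn_integral_distr) auto
  also have "\<dots> = (\<integral>\<^sup>+ \<omega>. \<integral>\<^sup>+ \<omega>'. f (\<omega>, \<omega>') \<partial>distr M H (\<lambda>x. x) \<partial>distr M G (\<lambda>x. x))"
    unfolding distr[symmetric]
    by (subst H.nn_integral_fst[symmetric]) (use f in \<open>auto cong: measurable_cong_sets\<close>)
  also have "\<dots> = (\<integral>\<^sup>+ \<omega>. \<integral>\<^sup>+ \<omega>'. f (\<omega>, \<omega>') \<partial>M \<partial>distr M G (\<lambda>x. x))"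
    by (intro nn_integral_cong nn_integral_distr) (use f in \<open>auto intro: measurable_Pair2\<close>)
  also have "\<dots> = (\<integral>\<^sup>+ \<omega>. \<integral>\<^sup>+ \<omega>'. f (\<omega>, \<omega>') \<partial>M \<partial>M)"
  proof (rule nn_integral_distr[OF id(1)])
    have "(\<lambda>\<omega>. \<integral>\<^sup>+ \<omega>'. f (\<omega>, \<omega>') \<partial>distr M H (\<lambda>x. x)) \<in> borel_measurable G"
      using f by (intro H.borel_measurable_nn_integral_fst) (auto cong: measurable_cong_sets)
    also have "?this \<longleftrightarrow> (\<lambda>\<omega>. \<integral>\<^sup>+ \<omega>'. f (\<omega>, \<omega>') \<partial>M) \<in> borel_measurable G"
      by (intro measurable_cong nn_integral_distr) (use f in \<open>auto intro: measurable_Pair2\<close>)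
    finally show "(\<lambda>\<omega>. \<integral>\<^sup>+ \<omega>'. f (\<omega>, \<omega>') \<partial>M) \<in> borel_measurable (distr M G (\<lambda>x. x))"
      by simp
  qed
  finally show ?thesis .
qed

text \<open>
  The marks are averaged out one at a time, the last one first: the \<open>\<sigma>\<close>-algebra \<open>A m\<close> is independent of
  the one generated by the points and \<open>A i\<close>, \<open>i < m\<close>. The average over the mark \<open>m\<close> is a function of the point
  \<open>X m\<close>. The factor \<open>Y\<close>, any function of the points, is there to absorb it in the induction.
\<close>

lemma (in prob_space) nn_integral_independent_marks:
  fixes X :: "nat \<Rightarrow> 'a \<Rightarrow> 's" and A :: "nat \<Rightarrow> 'a measure"
    and S :: "'s measure" and H :: "nat \<Rightarrow> 's \<times> 'a \<Rightarrow> ennreal"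
  defines "G0 \<equiv> vimage_algebra (space M) (\<lambda>\<omega> i. X i \<omega>) (Pi\<^sub>M UNIV (\<lambda>_. S))"
  assumes X: "\<And>i. X i \<in> measurable M S"
    and A: "\<And>i. space (A i) = space M" "\<And>i. sets (A i) \<subseteq> events"
    and indep: "indep_sets (case_option (sets G0) (\<lambda>i. sets (A i))) UNIV"
    and H: "\<And>i. H i \<in> borel_measurable (S \<Otimes>\<^sub>M A i)"
    and Y: "Y \<in> borel_measurable G0"
  shows "(\<integral>\<^sup>+ \<omega>. Y \<omega> * (\<Prod>i<m. H i (X i \<omega>, \<omega>)) \<partial>M) =
         (\<integral>\<^sup>+ \<omega>. Y \<omega> * (\<Prod>i<m. \<integral>\<^sup>+ \<omega>'. H i (X i \<omega>, \<omega>') \<partial>M) \<partial>M)"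
  using Y
proof (induction m arbitrary: Y)
  case 0
  then show ?case by simp
next
  case (Suc m)
  let ?E = "case_option (sets G0) (\<lambda>i. sets (A i))"
  let ?J = "insert None (Some ` {..<m})"
  have sG0: "space G0 = space M" by (simp add: G0_def)
  have G0_events: "sets G0 \<subseteq> events"
    using indep by (auto simp: indep_sets_def split: option.splits dest!: bspec[of _ _ None])
  have idA: "(\<lambda>x. x) \<in> measurable M (A i)" for i
    using A by (auto intro!: measurable_supalgebra[OF measurable_ident_sets])
  have X0: "X i \<in> measurable G0 S" for i
  proof -
    have "(\<lambda>\<omega> i. X i \<omega>) \<in> measurable G0 (Pi\<^sub>M UNIV (\<lambda>_. S))"
      unfolding G0_def using X by (intro measurable_vimage_algebra1) (auto simp: space_PiM dest: measurable_space)
    from measurable_compose[OF this measurable_component_singleton[of i]] show ?thesis by simp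
  qed
  have XS: "X i \<omega> \<in> space S" if "\<omega> \<in> space M" for i \<omega>
    using X that by (rule measurable_space)
  define G where "G = sigma (space M) (\<Union>j\<in>?J. ?E j)"
  have E_Pow: "?E j \<subseteq> Pow (space M)" for j
    using sets.sets_into_space[of _ G0] sets.sets_into_space[of _ "A _"] sG0 A(1) by (auto split: option.splits)
  have sG: "space G = space M" "sets G = sigma_sets (space M) (\<Union>j\<in>?J. ?E j)"
    unfolding G_def by (rule space_measure_of sets_measure_of, rule UN_least, rule E_Pow)+
  have "indep_sets (\<lambda>b. sigma_sets (space M) (\<Union>j\<in>(if b then ?J else {Some m}). ?E j)) (UNIV :: bool set)"
  proof (rule indep_sets_collect_sigma)
    show "indep_sets ?E (\<Union>b\<in>UNIV. if b then ?J else {Some m})"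
      using indep by (rule indep_sets_mono_index[rotated]) simp
    show "Int_stable (?E i)" for i
      by (cases i) (auto simp: Int_stable_def)
  qed (auto simp: disjoint_family_on_def)
  then have ind: "indep_set (sets G) (sets (A m))"
    unfolding indep_set_def
    by (rule indep_sets_mono_sets) (auto simp: sG split: bool.splits intro: sigma_sets.Basic)
  have G0G: "sets G0 \<subseteq> sets G" unfolding sG by (auto intro: sigma_sets.Basic)
  have AG: "sets (A i) \<subseteq> sets G" if "i < m" for i unfolding sG using that by (auto intro!: sigma_sets.Basic)
  have XG: "X i \<in> measurable G S" for i
    by (rule measurable_supalgebra[OF X0]) (use sG0 sG G0G in auto)
  have YG: "Y \<in> borel_measurable G"
    by (rule measurable_supalgebra[OF Suc.prems]) (use sG0 sG G0G in auto)
  have idG: "(\<lambda>x. x) \<in> measurable G (A i)" if "i < m" for i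
    using A(1) sG(1) AG[OF that] by (auto intro!: measurable_supalgebra[OF measurable_ident_sets])
  have HG: "(\<lambda>\<omega>. H i (X i \<omega>, \<omega>)) \<in> borel_measurable G" if "i < m" for i
    by (rule measurable_compose[OF _ H]) (use XG idG[OF that] in measurable)
  have HM: "(\<lambda>\<omega>. H i (X i \<omega>, \<omega>)) \<in> borel_measurable M" for i
    by (rule measurable_compose[OF _ H]) (use X idA in measurable)
  have HA: "(\<lambda>\<omega>'. H m (s, \<omega>')) \<in> borel_measurable M" if "s \<in> space S" for s
    by (rule measurable_supalgebra[OF measurable_compose[OF measurable_Pair1' H]]) (use A that in auto)
  let ?h = "\<lambda>s. \<integral>\<^sup>+ \<omega>'. H m (s, \<omega>') \<partial>M"
  have h: "?h \<in> borel_measurable S"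
  proof -
    interpret Am: prob_space "distr M (A m) (\<lambda>x. x)" by (rule prob_space_distr[OF idA])
    have "(\<lambda>s. \<integral>\<^sup>+ \<omega>'. H m (s, \<omega>') \<partial>distr M (A m) (\<lambda>x. x)) \<in> borel_measurable S"
      using H[of m] by (intro Am.borel_measurable_nn_integral_fst) (auto cong: measurable_cong_sets)
    also have "?this \<longleftrightarrow> ?h \<in> borel_measurable S"
      by (intro measurable_cong nn_integral_distr idA) (use H[of m] in \<open>auto intro: measurable_Pair2\<close>)
    finally show ?thesis .
  qed
  let ?f = "\<lambda>(\<omega>, \<omega>'). Y \<omega> * (\<Prod>i<m. H i (X i \<omega>, \<omega>)) * H m (X m \<omega>, \<omega>')"
  have "(\<lambda>z. H m (X m (fst z), snd z)) \<in> borel_measurable (G \<Otimes>\<^sub>M A m)"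
    by (rule measurable_compose[OF _ H]) (use XG in measurable)
  then have f: "?f \<in> borel_measurable (G \<Otimes>\<^sub>M A m)"
    unfolding split_beta'
    by (intro borel_measurable_times_ennreal borel_measurable_prod_ennreal measurable_compose[OF measurable_fst YG]
        measurable_compose[OF measurable_fst HG]) auto
  have "(\<integral>\<^sup>+ \<omega>. Y \<omega> * (\<Prod>i<Suc m. H i (X i \<omega>, \<omega>)) \<partial>M) = (\<integral>\<^sup>+ \<omega>. ?f (\<omega>, \<omega>) \<partial>M)"
    by (simp add: mult.assoc)
  also have "\<dots> = (\<integral>\<^sup>+ \<omega>. \<integral>\<^sup>+ \<omega>'. ?f (\<omega>, \<omega>') \<partial>M \<partial>M)"
    by (rule nn_integral_indep_subalgebras[OF ind sG(1) A(1) f])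
  also have "\<dots> = (\<integral>\<^sup>+ \<omega>. (Y \<omega> * ?h (X m \<omega>)) * (\<Prod>i<m. H i (X i \<omega>, \<omega>)) \<partial>M)"
    by (intro nn_integral_cong) (simp add: nn_integral_cmult HA XS, simp add: mult_ac)
  also have "\<dots> = (\<integral>\<^sup>+ \<omega>. (Y \<omega> * ?h (X m \<omega>)) * (\<Prod>i<m. \<integral>\<^sup>+ \<omega>'. H i (X i \<omega>, \<omega>') \<partial>M) \<partial>M)"
    by (rule Suc.IH) (use Suc.prems measurable_compose[OF X0 h] in measurable)
  also have "\<dots> = (\<integral>\<^sup>+ \<omega>. Y \<omega> * (\<Prod>i<Suc m. \<integral>\<^sup>+ \<omega>'. H i (X i \<omega>, \<omega>') \<partial>M) \<partial>M)"
    by (simp add: mult_ac)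
  finally show ?case .
qed

section \<open>Finite-dimensional distributions of nonnegative processes\<close>

text \<open>
  These cylinder sets form a generator closed under intersection, whose measures are the values of the
  finite-dimensional distribution functions. The index set \<open>I\<close> may be infinite: \<open>I = UNIV\<close> is the path
  space.
\<close>

definition lower_boxes :: "'t set \<Rightarrow> ('t \<Rightarrow> real) set set" where
  "lower_boxes I = {{f \<in> I \<rightarrow>\<^sub>E UNIV. \<forall>t\<in>J. f t \<le> a t} | J a. finite J \<and> J \<subseteq> I}"

lemma sets_PiM_lower_boxes:
  "sets (Pi\<^sub>M I (\<lambda>_. borel :: real measure)) = sigma_sets (I \<rightarrow>\<^sub>E UNIV) (lower_boxes I)"
proof -
  let ?P = "{{f \<in> I \<rightarrow>\<^sub>E UNIV. \<forall>i\<in>j. f i \<in> A i} | A j. j \<in> {J. finite J \<and> J \<subseteq> I} \<and> A \<in> Pi j (\<lambda>_. range (atMost :: real \<Rightarrow> _))}"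
  have P: "?P = lower_boxes I"
  proof (intro equalityI subsetI)
    fix B assume "B \<in> ?P"
    then obtain A j where B: "B = {f \<in> I \<rightarrow>\<^sub>E UNIV. \<forall>i\<in>j. f i \<in> A i}" and j: "finite j" "j \<subseteq> I"
      and A: "A \<in> Pi j (\<lambda>_. range (atMost :: real \<Rightarrow> _))" by auto
    have "\<forall>i\<in>j. \<exists>a. A i = {..a}" using A by (auto simp: Pi_iff)
    then obtain a where a: "\<And>i. i \<in> j \<Longrightarrow> A i = {..a i}" by metis
    have "B = {f \<in> I \<rightarrow>\<^sub>E UNIV. \<forall>i\<in>j. f i \<le> a i}" unfolding B using a by auto
    then show "B \<in> lower_boxes I" unfolding lower_boxes_def using j by auto
  next
    fix B assume "B \<in> lower_boxes I"
    then obtain j a where B: "B = {f \<in> I \<rightarrow>\<^sub>E UNIV. \<forall>i\<in>j. f i \<le> (a i :: real)}" and j: "finite j" "j \<subseteq> I"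
      by (auto simp: lower_boxes_def)
    show "B \<in> ?P"
      unfolding B using j by (auto intro!: exI[of _ "\<lambda>i. {..a i}"] exI[of _ j])
  qed
  have "sets (Pi\<^sub>M I (\<lambda>_. borel :: real measure)) = sets (Pi\<^sub>M I (\<lambda>_. sigma UNIV (range (atMost :: real \<Rightarrow> _))))"
    by (simp add: borel_eq_atMost)
  also have "\<dots> = sets (sigma (I \<rightarrow>\<^sub>E UNIV) ?P)"
  proof (rule sets_PiM_sigma)
    show "\<exists>S\<subseteq>range (atMost :: real \<Rightarrow> _). countable S \<and> UNIV = \<Union>S"
      by (rule exI[of _ "range (\<lambda>n::nat. {..real n})"]) (auto intro: real_arch_simple)
  qed auto
  also have "\<dots> = sigma_sets (I \<rightarrow>\<^sub>E UNIV) ?P"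
    by (rule sets_measure_of) auto
  finally show ?thesis unfolding P .
qed

lemma Int_stable_lower_boxes: "Int_stable (lower_boxes I)"
proof (rule Int_stableI)
  fix B B' assume "B \<in> lower_boxes I" "B' \<in> lower_boxes I"
  then obtain J a J' a' where B: "B = {f \<in> I \<rightarrow>\<^sub>E UNIV. \<forall>t\<in>J. f t \<le> a t}" "finite J" "J \<subseteq> I"
    and B': "B' = {f \<in> I \<rightarrow>\<^sub>E UNIV. \<forall>t\<in>J'. f t \<le> a' t}" "finite J'" "J' \<subseteq> I"
    unfolding lower_boxes_def by blast
  let ?b = "\<lambda>t. if t \<in> J then if t \<in> J' then min (a t) (a' t) else a t else a' t"
  have "B \<inter> B' = {f \<in> I \<rightarrow>\<^sub>E UNIV. \<forall>t\<in>J \<union> J'. f t \<le> ?b t}"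
    unfolding B B' by (auto split: if_splits)
  then show "B \<inter> B' \<in> lower_boxes I"
    unfolding lower_boxes_def using B B' by (intro CollectI exI[of _ "J \<union> J'"] exI[of _ ?b]) auto
qed

lemma space_in_lower_boxes: "I \<rightarrow>\<^sub>E UNIV \<in> lower_boxes I"
  unfolding lower_boxes_def by (intro CollectI exI[of _ "{}"]) auto

lemma lower_box_measurable:
  assumes "finite J" "J \<subseteq> I"
  shows "{f \<in> I \<rightarrow>\<^sub>E UNIV. \<forall>t\<in>J. f t \<le> (a t :: real)} \<in> sets (Pi\<^sub>M I (\<lambda>_. borel))"
  unfolding sets_PiM_lower_boxes using assms by (intro sigma_sets.Basic) (auto simp: lower_boxes_def)

lemma emeasure_negative_threshold:
  assumes nonneg: "\<And>t. t \<in> J \<Longrightarrow> AE \<omega> in M. 0 \<le> X t \<omega>" and t: "t \<in> J" "a t < (0::real)"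
  shows "emeasure M {\<omega> \<in> space M. \<forall>t\<in>J. X t \<omega> \<le> a t} = 0"
proof (cases "{\<omega> \<in> space M. \<forall>t\<in>J. X t \<omega> \<le> a t} \<in> sets M")
  case True
  have "AE \<omega> in M. \<not> (\<forall>t\<in>J. X t \<omega> \<le> a t)"
    using nonneg[OF t(1)] by eventually_elim (use t in force)
  then show ?thesis using True by (subst AE_iff_measurable[symmetric]) auto
qed (simp add: emeasure_notin_sets)

text \<open>
  For nonnegative processes it suffices to compare the distribution functions at nonnegative
  thresholds, since a negative threshold gives probability \<open>0\<close>.
\<close>

lemma same_fdds_cdfI:
  fixes X :: "'t \<Rightarrow> 'w \<Rightarrow> real" and Y :: "'t \<Rightarrow> 'v \<Rightarrow> real"
  assumes X: "stochastic_process M X" and Y: "stochastic_process N Y"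
    and nonneg: "\<And>t. AE \<omega> in M. 0 \<le> X t \<omega>" "\<And>t. AE \<omega> in N. 0 \<le> Y t \<omega>"
    and cdf: "\<And>J a. finite J \<Longrightarrow> (\<And>t. t \<in> J \<Longrightarrow> 0 \<le> a t) \<Longrightarrow>
      emeasure M {\<omega> \<in> space M. \<forall>t\<in>J. X t \<omega> \<le> a t} = emeasure N {\<omega> \<in> space N. \<forall>t\<in>J. Y t \<omega> \<le> a t}"
  shows "same_fdds M X N Y"
  unfolding same_fdds_def
proof (intro allI impI)
  fix I :: "'t set" assume I: "finite I"
  interpret M: prob_space M using X by (simp add: stochastic_process_def)
  interpret N: prob_space N using Y by (simp add: stochastic_process_def)
  have [measurable]: "X t \<in> borel_measurable M" "Y t \<in> borel_measurable N" for t
    using X Y by (auto simp: stochastic_process_def)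
  have cdf': "emeasure M {\<omega> \<in> space M. \<forall>t\<in>J. X t \<omega> \<le> a t} = emeasure N {\<omega> \<in> space N. \<forall>t\<in>J. Y t \<omega> \<le> a t}"
    if "finite J" for J a
  proof (cases "\<forall>t\<in>J. 0 \<le> a t")
    case False
    then obtain t where t: "t \<in> J" "a t < 0" by (auto simp: not_le)
    show ?thesis
      using emeasure_negative_threshold[where J = J and M = M and X = X and t = t and a = a] emeasure_negative_threshold[where J = J and M = N and X = Y and t = t and a = a] nonneg t by simp
  qed (use cdf that in auto)
  show "fdd M X I = fdd N Y I"
  proof (rule measure_eqI_generator_eq[where E = "lower_boxes I" and \<Omega> = "I \<rightarrow>\<^sub>E UNIV" and A = "\<lambda>_. I \<rightarrow>\<^sub>E UNIV"])
    show "sets (fdd M X I) = sigma_sets (I \<rightarrow>\<^sub>E UNIV) (lower_boxes I)"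
      "sets (fdd N Y I) = sigma_sets (I \<rightarrow>\<^sub>E UNIV) (lower_boxes I)"
      by (simp_all add: fdd_def sets_PiM_lower_boxes)
    fix B assume B: "B \<in> lower_boxes I"
    then obtain J a where J: "B = {f \<in> I \<rightarrow>\<^sub>E UNIV. \<forall>t\<in>J. f t \<le> a t}" "finite J" "J \<subseteq> I"
      unfolding lower_boxes_def by blast
    have Bs: "B \<in> sets (Pi\<^sub>M I (\<lambda>_. borel))" using B by (auto simp: sets_PiM_lower_boxes)
    have "emeasure (fdd M X I) B = emeasure M {\<omega> \<in> space M. \<forall>t\<in>J. X t \<omega> \<le> a t}"
      unfolding fdd_def using J(3) Bs
      by (subst emeasure_distr) (auto simp: J(1) intro!: arg_cong[where f = "emeasure M"])
    moreover have "emeasure (fdd N Y I) B = emeasure N {\<omega> \<in> space N. \<forall>t\<in>J. Y t \<omega> \<le> a t}"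
      unfolding fdd_def using J(3) Bs
      by (subst emeasure_distr) (auto simp: J(1) intro!: arg_cong[where f = "emeasure N"])
    ultimately show "emeasure (fdd M X I) B = emeasure (fdd N Y I) B" using cdf'[OF J(2)] by simp
  next
    interpret F: prob_space "fdd M X I" unfolding fdd_def by (intro M.prob_space_distr) measurable
    show "emeasure (fdd M X I) (I \<rightarrow>\<^sub>E UNIV) \<noteq> \<infinity>"
      by simp
  qed (auto simp: Int_stable_lower_boxes space_in_lower_boxes, auto simp: lower_boxes_def)
qed

text \<open>
  The processes \<open>Z k\<close> are carried over to the path space \<open>nat \<Rightarrow> 't \<Rightarrow> real\<close>. There the factorization of the joint
  distribution function into the factors \<open>G\<close> is independence on a generator of the product \<open>\<sigma>\<close>-algebra. Taking \<open>J i\<close>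
  empty except for one index gives the marginals, and taking the same \<open>J\<close> for all indices gives the maximum.
\<close>

lemma iid_decomposition:
  fixes X :: "'t \<Rightarrow> 'w \<Rightarrow> real" and Z :: "nat \<Rightarrow> 't \<Rightarrow> 'v \<Rightarrow> real"
    and G :: "'t set \<Rightarrow> ('t \<Rightarrow> real) \<Rightarrow> ennreal"
  assumes n: "n \<ge> 1"
    and X: "stochastic_process M X" "\<And>t. AE \<omega> in M. 0 \<le> X t \<omega>"
    and M': "prob_space M'" and Z[measurable]: "\<And>k t. Z k t \<in> borel_measurable M'"
    and Z_nonneg: "\<And>k t. AE w in M'. 0 \<le> Z k t w"
    and G_empty: "\<And>a. G {} a = 1"
    and joint: "\<And>J a. (\<And>k. k < n \<Longrightarrow> finite (J k)) \<Longrightarrow> (\<And>k t. k < n \<Longrightarrow> t \<in> J k \<Longrightarrow> 0 \<le> a k t) \<Longrightarrow>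
        emeasure M' {w \<in> space M'. \<forall>k<n. \<forall>t\<in>J k. Z k t w \<le> a k t} = (\<Prod>k<n. G (J k) (a k))"
    and cdf: "\<And>J a. finite J \<Longrightarrow> (\<And>t. t \<in> J \<Longrightarrow> 0 \<le> a t) \<Longrightarrow>
        emeasure M {\<omega> \<in> space M. \<forall>t\<in>J. X t \<omega> \<le> a t} = G J a ^ n"
  shows "\<exists>(N :: (nat \<Rightarrow> 't \<Rightarrow> real) measure) Y. prob_space N \<and> iid_processes N n Y \<and>
        same_fdds M X N (\<lambda>t \<omega>. MAX k\<in>{..<n}. Y k t \<omega>)"
proof -
  interpret M': prob_space M' by fact
  let ?P = "Pi\<^sub>M UNIV (\<lambda>_::'t. borel :: real measure)"
  let ?Q = "Pi\<^sub>M UNIV (\<lambda>_::nat. ?P)"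
  define T where "T w k t = Z k t w" for w k t
  define N where "N = distr M' ?Q T"
  define Y where "Y k t y = y k t" for k :: nat and t :: 't and y :: "nat \<Rightarrow> 't \<Rightarrow> real"
  have T[measurable]: "T \<in> measurable M' ?Q"
    unfolding T_def by (intro measurable_abs_UNIV Z)
  interpret N: prob_space N unfolding N_def by (rule M'.prob_space_distr[OF T])
  have sN: "space N = UNIV" "sets N = sets ?Q" by (auto simp: N_def space_PiM)
  have compP: "(\<lambda>y. y k) \<in> measurable N ?P" for k
    using measurable_component_singleton[of k UNIV "\<lambda>_. ?P"] by (simp add: measurable_cong_sets[OF sN(2) refl])
  have Y[measurable]: "Y k t \<in> borel_measurable N" for k t
    unfolding Y_def by (rule measurable_compose[OF compP measurable_component_singleton]) simp
  have procY: "stochastic_process N (Y k)" for k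
    by (simp add: stochastic_process_def N.prob_space_axioms)
  have Y_nonneg: "AE y in N. 0 \<le> Y k t y" for k t
  proof -
    have "{y \<in> space N. 0 \<le> Y k t y} \<in> sets N" by measurable
    then have "{y \<in> space ?Q. 0 \<le> Y k t y} \<in> sets ?Q"
      by (simp add: sN space_PiM)
    then show ?thesis
      unfolding N_def using Z_nonneg[of k t] by (subst AE_distr_iff[OF T]) (auto simp: Y_def T_def)
  qed
  have cdfN: "emeasure N {y. \<forall>k<n. \<forall>t\<in>J k. Y k t y \<le> a k t} = (\<Prod>k<n. G (J k) (a k))"
    if J: "\<And>k. k < n \<Longrightarrow> finite (J k)" and a: "\<And>k t. k < n \<Longrightarrow> t \<in> J k \<Longrightarrow> 0 \<le> a k t" for J a
  proof -
    have "{y \<in> space N. \<forall>k\<in>{..<n}. \<forall>t\<in>J k. Y k t y \<le> a k t} \<in> sets N"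
      using J by (intro sets.sets_Collect_finite_All' sets.sets_Collect_finite_All) auto
    then have "{y. \<forall>k<n. \<forall>t\<in>J k. Y k t y \<le> a k t} \<in> sets ?Q" using sN by (simp add: Ball_def)
    then have "emeasure N {y. \<forall>k<n. \<forall>t\<in>J k. Y k t y \<le> a k t} = emeasure M' (T -` {y. \<forall>k<n. \<forall>t\<in>J k. Y k t y \<le> a k t} \<inter> space M')"
      unfolding N_def by (rule emeasure_distr[OF T])
    also have "T -` {y. \<forall>k<n. \<forall>t\<in>J k. Y k t y \<le> a k t} \<inter> space M' = {w \<in> space M'. \<forall>k<n. \<forall>t\<in>J k. Z k t w \<le> a k t}"
      by (auto simp: T_def Y_def)
    finally show ?thesis using joint[OF J a] by simp
  qed
  have cdf1: "emeasure N {y. \<forall>t\<in>J. Y k t y \<le> a t} = G J a"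
    if "k < n" "finite J" "\<And>t. t \<in> J \<Longrightarrow> 0 \<le> a t" for J a k
  proof -
    let ?J = "\<lambda>i. if i = k then J else {}"
    have "{y. \<forall>t\<in>J. Y k t y \<le> a t} = {y. \<forall>i<n. \<forall>t\<in>?J i. Y i t y \<le> a t}"
      using that(1) by auto
    then have "emeasure N {y. \<forall>t\<in>J. Y k t y \<le> a t} = (\<Prod>i<n. G (?J i) a)"
      using that by (simp only:) (rule cdfN, auto split: if_splits)
    also have "\<dots> = (\<Prod>i<n. if i = k then G J a else 1)"
      by (intro prod.cong) (auto simp: G_empty)
    finally show ?thesis using that(1) by simp
  qed
  have "N.indep_vars (\<lambda>_. ?P) (\<lambda>k \<omega> t. Y k t \<omega>) {..<n}"
  proof (subst N.indep_vars_finite[where E = "\<lambda>_. lower_boxes UNIV"])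
    show "\<forall>A\<in>{..<n} \<rightarrow> lower_boxes UNIV. N.prob (\<Inter>k\<in>{..<n}. (\<lambda>\<omega> t. Y k t \<omega>) -` A k \<inter> space N) =
        (\<Prod>k<n. N.prob ((\<lambda>\<omega> t. Y k t \<omega>) -` A k \<inter> space N))"
    proof
      fix A :: "nat \<Rightarrow> ('t \<Rightarrow> real) set" assume A: "A \<in> {..<n} \<rightarrow> lower_boxes UNIV"
      have "\<forall>k\<in>{..<n}. \<exists>B. A k = {f. \<forall>t\<in>fst B. f t \<le> snd B t} \<and> finite (fst B)"
      proof
        fix k assume "k \<in> {..<n}"
        then have "A k \<in> lower_boxes UNIV" using A by auto
        then obtain J a where "A k = {f. \<forall>t\<in>J. f t \<le> a t}" "finite J"
          unfolding lower_boxes_def by auto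
        then show "\<exists>B. A k = {f. \<forall>t\<in>fst B. f t \<le> snd B t} \<and> finite (fst B)"
          by (intro exI[of _ "(J, a)"]) simp
      qed
      from bchoice[OF this] obtain B
        where B: "\<forall>k\<in>{..<n}. A k = {f. \<forall>t\<in>fst (B k). f t \<le> snd (B k) t} \<and> finite (fst (B k))" ..
      define J where "J k = fst (B k)" for k
      define a where "a k = snd (B k)" for k
      have A_eq: "A k = {f. \<forall>t\<in>J k. f t \<le> a k t}" and J: "finite (J k)" if "k < n" for k
        using B that by (auto simp: J_def a_def)
      have pre: "(\<lambda>\<omega> t. Y k t \<omega>) -` A k \<inter> space N = {y. \<forall>t\<in>J k. Y k t y \<le> a k t}" if "k < n" for k
        unfolding A_eq[OF that] sN by (rule set_eqI) (simp only: vimage_Collect_eq Int_UNIV_right mem_Collect_eq)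
      have inter: "(\<Inter>k\<in>{..<n}. (\<lambda>\<omega> t. Y k t \<omega>) -` A k \<inter> space N) = {y. \<forall>k<n. \<forall>t\<in>J k. Y k t y \<le> a k t}"
      proof -
        have "(\<Inter>k\<in>{..<n}. (\<lambda>\<omega> t. Y k t \<omega>) -` A k \<inter> space N) = (\<Inter>k\<in>{..<n}. {y. \<forall>t\<in>J k. Y k t y \<le> a k t})"
          by (intro INF_cong refl pre) simp
        then show ?thesis by auto
      qed
      have meas: "{y. \<forall>t\<in>J k. Y k t y \<le> a k t} \<in> sets N" if "k < n" for k
      proof -
        have "{y \<in> space N. \<forall>t\<in>J k. Y k t y \<le> a k t} \<in> sets N"
          using J[OF that] by (intro sets.sets_Collect_finite_All) auto
        then show ?thesis by (simp add: sN)
      qed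
      have "emeasure N {y. \<forall>k<n. \<forall>t\<in>J k. Y k t y \<le> a k t} = (\<Prod>k<n. emeasure N {y. \<forall>t\<in>J k. Y k t y \<le> a k t})"
      proof (cases "\<forall>k<n. \<forall>t\<in>J k. 0 \<le> a k t")
        case True
        then have "emeasure N {y. \<forall>k<n. \<forall>t\<in>J k. Y k t y \<le> a k t} = (\<Prod>k<n. G (J k) (a k))"
          using J by (intro cdfN) auto
        also have "\<dots> = (\<Prod>k<n. emeasure N {y. \<forall>t\<in>J k. Y k t y \<le> a k t})"
          using True J by (intro prod.cong cdf1[symmetric]) auto
        finally show ?thesis .
      next
        case False
        then obtain k t where kt: "k < n" "t \<in> J k" "a k t < 0" by (auto simp: not_le)
        have 0: "emeasure N {y. \<forall>t\<in>J k. Y k t y \<le> a k t} = 0"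
          using emeasure_negative_threshold[where J = "J k" and M = N and X = "Y k" and t = t and a = "a k"] Y_nonneg kt by (simp add: sN)
        have "emeasure N {y. \<forall>k<n. \<forall>t\<in>J k. Y k t y \<le> a k t} \<le> emeasure N {y. \<forall>t\<in>J k. Y k t y \<le> a k t}"
          using kt(1) meas[OF kt(1)] by (intro emeasure_mono) auto
        moreover have "(\<Prod>k<n. emeasure N {y. \<forall>t\<in>J k. Y k t y \<le> a k t}) = 0"
          using 0 kt(1) by (intro prod_zero) auto
        ultimately show ?thesis using 0 by simp
      qed
      then have "ennreal (N.prob {y. \<forall>k<n. \<forall>t\<in>J k. Y k t y \<le> a k t}) = ennreal (\<Prod>k<n. N.prob {y. \<forall>t\<in>J k. Y k t y \<le> a k t})"
        by (simp add: N.emeasure_eq_measure prod_ennreal)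
      then have "N.prob {y. \<forall>k<n. \<forall>t\<in>J k. Y k t y \<le> a k t} = (\<Prod>k<n. N.prob {y. \<forall>t\<in>J k. Y k t y \<le> a k t})"
        by (subst (asm) ennreal_inj) (auto intro: prod_nonneg)
      then show "N.prob (\<Inter>k\<in>{..<n}. (\<lambda>\<omega> t. Y k t \<omega>) -` A k \<inter> space N) =
          (\<Prod>k<n. N.prob ((\<lambda>\<omega> t. Y k t \<omega>) -` A k \<inter> space N))"
        unfolding inter by (simp add: pre)
    qed
  qed (use n compP space_in_lower_boxes[of "UNIV :: 't set"] in
      \<open>auto simp: Y_def space_PiM sets_PiM_lower_boxes Int_stable_lower_boxes lessThan_empty_iff\<close>)
  moreover have "same_fdds N (Y j) N (Y k)" if "j < n" "k < n" for j k
    by (rule same_fdds_cdfI[OF procY procY Y_nonneg Y_nonneg]) (use that in \<open>simp add: cdf1 sN\<close>)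
  ultimately have iid: "iid_processes N n Y"
    using procY by (simp add: iid_processes_def)
  have "same_fdds M X N (\<lambda>t \<omega>. MAX k\<in>{..<n}. Y k t \<omega>)"
  proof (rule same_fdds_cdfI[OF X(1) _ X(2)])
    show "stochastic_process N (\<lambda>t \<omega>. MAX k\<in>{..<n}. Y k t \<omega>)"
      by (auto simp: stochastic_process_def N.prob_space_axioms intro!: borel_measurable_Max)
    show "AE y in N. 0 \<le> (MAX k\<in>{..<n}. Y k t y)" for t
      using Y_nonneg[of 0 t]
    proof eventually_elim
      case (elim y)
      have "Y 0 t y \<le> (MAX k\<in>{..<n}. Y k t y)" using n by (intro Max_ge) auto
      with elim show ?case by simp
    qed
    fix J :: "'t set" and a assume J: "finite J" "\<And>t. t \<in> J \<Longrightarrow> 0 \<le> (a t :: real)"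
    have "{y \<in> space N. \<forall>t\<in>J. (MAX k\<in>{..<n}. Y k t y) \<le> a t} = {y. \<forall>k<n. \<forall>t\<in>J. Y k t y \<le> a t}"
      using n by (auto simp: sN Max_le_iff lessThan_empty_iff)
    then show "emeasure M {\<omega> \<in> space M. \<forall>t\<in>J. X t \<omega> \<le> a t} = emeasure N {y \<in> space N. \<forall>t\<in>J. (MAX k\<in>{..<n}. Y k t y) \<le> a t}"
      using cdf[OF J] cdfN[of "\<lambda>_. J" "\<lambda>_. a"] J by simp
  qed
  with iid N.prob_space_axioms show ?thesis by blast
qed

section \<open>Suprema of sequences of reals\<close>

text \<open>
  On \<open>real\<close> the supremum of an unbounded set is unspecified, but it is the same number for all of them,
  since \<open>Sup\<close> only depends on the set of upper bounds.
\<close>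

lemma borel_measurable_real_SUP:
  fixes f :: "nat \<Rightarrow> 'a \<Rightarrow> real"
  assumes [measurable]: "\<And>i. f i \<in> borel_measurable M"
  shows "(\<lambda>\<omega>. SUP i. f i \<omega>) \<in> borel_measurable M"
proof -
  let ?U = "\<lambda>\<omega>. \<exists>n::nat. \<forall>i. f i \<omega> \<le> real n"
  have U: "?U \<omega> \<longleftrightarrow> bdd_above (range (\<lambda>i. f i \<omega>))" for \<omega>
    by (auto simp: bdd_above_def) (meson order_trans real_arch_simple)
  have unbounded: "Sup A = (LEAST z :: real. False)" if "\<not> bdd_above A" for A
  proof -
    have "(\<lambda>z. \<forall>x\<in>A. x \<le> z) = (\<lambda>_. False)" using that by (auto simp: bdd_above_def fun_eq_iff)
    then show ?thesis unfolding Sup_real_def by simp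
  qed
  have "(SUP i. f i \<omega>) = (if ?U \<omega> then SUP i. (if ?U \<omega> then f i \<omega> else 0) else (LEAST z. False))" for \<omega>
    using unbounded U[of \<omega>] by auto
  moreover have "(\<lambda>\<omega>. if ?U \<omega> then SUP i. (if ?U \<omega> then f i \<omega> else 0) else (LEAST z. False)) \<in> borel_measurable M"
  proof (intro measurable_If borel_measurable_cSUP)
    show "bdd_above ((\<lambda>i. if ?U \<omega> then f i \<omega> else 0) ` UNIV)" for \<omega>
      using U[of \<omega>] by (cases "?U \<omega>") auto
  qed measurable
  ultimately show ?thesis by simp
qed

text \<open>
  A positive value has only finitely many values above some smaller positive level, among which the
  largest is the maximum.
\<close>

lemma maximum_attained:
  fixes x :: "nat \<Rightarrow> real"
  assumes nonneg: "\<And>i. 0 \<le> x i" and fin: "\<And>k. finite {i. 1 / real (Suc k) < x i}"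
  shows "\<exists>i. \<forall>j. x j \<le> x i"
proof (cases "\<forall>j. x j \<le> 0")
  case True
  then show ?thesis using nonneg by (intro exI[of _ 0]) (auto intro: order_trans)
next
  case False
  then obtain j0 where j0: "0 < x j0" by (auto simp: not_le)
  then obtain k where k: "1 / real (Suc k) < x j0"
    using reals_Archimedean by (auto simp: inverse_eq_divide)
  let ?S = "{i. 1 / real (Suc k) < x i}"
  have S: "finite ?S" "?S \<noteq> {}" using fin[of k] k by auto
  then have "Max (x ` ?S) \<in> x ` ?S" by (intro Max_in) auto
  then obtain i where i: "i \<in> ?S" "Max (x ` ?S) = x i" by auto
  have "x j \<le> x i" for j
  proof (cases "j \<in> ?S")
    case True
    then show ?thesis using S i by (auto simp flip: i(2))
  qed (use i in auto)
  then show ?thesis by blast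
qed

lemma real_SUP_le_iff:
  fixes x :: "nat \<Rightarrow> real"
  assumes "\<exists>i. \<forall>j. x j \<le> x i"
  shows "(SUP i. x i) \<le> c \<longleftrightarrow> (\<forall>i. x i \<le> c)"
proof -
  have "bdd_above (range x)" using assms by (auto simp: bdd_above_def)
  then show ?thesis by (subst cSUP_le_iff) auto
qed

lemma real_SUP_restricted_le_iff:
  fixes x :: "nat \<Rightarrow> real"
  assumes "\<exists>i. \<forall>j. x j \<le> x i" and "0 \<le> c"
  shows "(SUP i. if Q i then x i else 0) \<le> c \<longleftrightarrow> (\<forall>i. Q i \<longrightarrow> x i \<le> c)"
proof -
  obtain i0 where "\<And>j. x j \<le> x i0" using assms(1) by auto
  then have "bdd_above (range (\<lambda>i. if Q i then x i else 0))"
    by (auto simp: bdd_above_def intro!: exI[of _ "max 0 (x i0)"] simp: le_max_iff_disj)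
  then show ?thesis using assms(2) by (subst cSUP_le_iff) (auto split: if_splits)
qed

lemma real_SUP_restricted_nonneg:
  fixes x :: "nat \<Rightarrow> real"
  assumes "\<exists>i. \<forall>j. x j \<le> x i" and "\<forall>i. 0 \<le> x i"
  shows "0 \<le> (SUP i. if Q i then x i else 0)"
proof -
  obtain i0 where "\<And>j. x j \<le> x i0" using assms(1) by auto
  then have "bdd_above (range (\<lambda>i. if Q i then x i else 0))"
    by (auto simp: bdd_above_def intro!: exI[of _ "max 0 (x i0)"] simp: le_max_iff_disj)
  then show ?thesis using assms(2) by (intro cSUP_upper2[where x = 0]) auto
qed

section \<open>The intensity measure on lines\<close>

lemma measurable_abs_angle [measurable]: "abs_angle \<in> borel_measurable borel"
  by (rule borel_measurable_continuous_onI[OF continuous_abs_angle])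

lemma measurable_cos_angle [measurable]: "cos_angle \<in> borel_measurable borel"
proof (rule borel_measurable_continuous_onI)
  have "abs_angle -` (cos_angle -` B) = cos -` B" for B
    by (auto simp: cos_angle.abs_eq)
  then show "continuous_on UNIV cos_angle"
    using continuous_on_cos[OF continuous_on_id, of UNIV]
    by (auto simp: continuous_on_open_vimage open_angle_def)
qed

lemma measurable_sin_angle [measurable]: "sin_angle \<in> borel_measurable borel"
proof (rule borel_measurable_continuous_onI)
  have "abs_angle -` (sin_angle -` B) = sin -` B" for B
    by (auto simp: sin_angle.abs_eq)
  then show "continuous_on UNIV sin_angle"
    using continuous_on_sin[OF continuous_on_id, of UNIV]
    by (auto simp: continuous_on_open_vimage open_angle_def)
qed

lemma space_angle_measure [simp]: "space angle_measure = UNIV"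
  and sets_angle_measure [simp, measurable_cong]: "sets angle_measure = sets borel"
  by (simp_all add: angle_measure_def)

lemma emeasure_angle_measure_UNIV: "emeasure angle_measure UNIV = ennreal (2 * pi)"
  unfolding angle_measure_def
  by (subst emeasure_distr) (auto simp: space_restrict_space emeasure_restrict_space intro!: measurable_restrict_space1)

lemma finite_measure_angle_measure: "finite_measure angle_measure"
  by (rule finite_measureI) (simp add: emeasure_angle_measure_UNIV)

interpretation angle: finite_measure angle_measure
  by (rule finite_measure_angle_measure)

interpretation line: pair_sigma_finite lborel angle_measure
  ..

lemma space_line_intensity [simp]: "space (line_intensity c) = UNIV"
  and sets_line_intensity [measurable_cong]: "sets (line_intensity c) = sets (borel \<Otimes>\<^sub>M borel)"
proof -
  show "sets (line_intensity c) = sets (borel \<Otimes>\<^sub>M borel)"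
    by (simp add: line_intensity_def cong: sets_pair_measure_cong)
  then show "space (line_intensity c) = UNIV"
    by (auto dest: sets_eq_imp_space_eq simp: space_pair_measure)
qed

lemma nn_integral_line_intensity:
  assumes [measurable]: "f \<in> borel_measurable (borel \<Otimes>\<^sub>M borel)"
  shows "(\<integral>\<^sup>+ s. f s \<partial>line_intensity c) = ennreal c * (\<integral>\<^sup>+ \<theta>. \<integral>\<^sup>+ t. f (t, \<theta>) \<partial>lborel \<partial>angle_measure)"
  unfolding line_intensity_def
  by (subst nn_integral_scale_measure) (simp_all add: line.nn_integral_snd)

lemma sigma_finite_line_intensity: "sigma_finite_measure (line_intensity c)"
proof
  let ?A = "range (\<lambda>n::nat. {- real n..real n} \<times> (UNIV :: angle set))"
  have "(x, \<theta>) \<in> \<Union>?A" for x \<theta>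
  proof -
    obtain n where "\<bar>x\<bar> \<le> real n" using real_arch_simple by blast
    then show ?thesis by (auto intro!: exI[of _ n])
  qed
  moreover have "emeasure (line_intensity c) ({- real n..real n} \<times> UNIV) \<noteq> \<infinity>" for n
    unfolding line_intensity_def
    by (simp add: emeasure_scale_measure angle.emeasure_pair_measure_Times emeasure_angle_measure_UNIV ennreal_mult_eq_top_iff)
  ultimately show "\<exists>A. countable A \<and> A \<subseteq> sets (line_intensity c) \<and> \<Union>A = space (line_intensity c) \<and>
      (\<forall>a\<in>A. emeasure (line_intensity c) a \<noteq> \<infinity>)"
    by (intro exI[of _ ?A]) (auto simp: sets_line_intensity)
qed

text \<open>
  The time at which the mark of the line \<open>s = (r, \<phi>)\<close> is evaluated at the point \<open>p\<close>: the signed distance of \<open>p\<close> from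
  the line. Thus \<open>phase h (0, \<phi>)\<close> is the component of \<open>h\<close> in the direction \<open>\<phi>\<close>.
\<close>

definition phase :: "real \<times> real \<Rightarrow> real \<times> angle \<Rightarrow> real" where
  "phase p s = fst p * cos_angle (snd s) + snd p * sin_angle (snd s) - fst s"

lemma measurable_phase [measurable]: "phase p \<in> borel_measurable (borel \<Otimes>\<^sub>M borel)"
  unfolding phase_def by measurable

text \<open>
  For each angle \<open>\<theta>\<close> the map is a translation of the first coordinate, which preserves Lebesgue measure.
\<close>

lemma nn_integral_line_intensity_shift:
  assumes [measurable]: "f \<in> borel_measurable (borel \<Otimes>\<^sub>M borel)"
  shows "(\<integral>\<^sup>+ s. f (fst s - phase h (0, snd s), snd s) \<partial>line_intensity c) = (\<integral>\<^sup>+ s. f s \<partial>line_intensity c)"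
proof -
  have "(\<lambda>s. (fst s - phase h (0, snd s), snd s)) \<in> borel \<Otimes>\<^sub>M borel \<rightarrow>\<^sub>M borel \<Otimes>\<^sub>M borel"
    unfolding phase_def fst_conv snd_conv by measurable
  from measurable_compose[OF this assms]
  have "(\<integral>\<^sup>+ s. f (fst s - phase h (0, snd s), snd s) \<partial>line_intensity c)
    = ennreal c * (\<integral>\<^sup>+ \<theta>. \<integral>\<^sup>+ t. f (t - phase h (0, \<theta>), \<theta>) \<partial>lborel \<partial>angle_measure)"
    by (subst nn_integral_line_intensity) auto
  also have "\<dots> = ennreal c * (\<integral>\<^sup>+ \<theta>. \<integral>\<^sup>+ t. f (t, \<theta>) \<partial>lborel \<partial>angle_measure)"
  proof (rule arg_cong[where f = "\<lambda>x. ennreal c * x"], rule nn_integral_cong)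
    fix \<theta> :: angle
    show "(\<integral>\<^sup>+ t. f (t - phase h (0, \<theta>), \<theta>) \<partial>lborel) = (\<integral>\<^sup>+ t. f (t, \<theta>) \<partial>lborel)"
      by (subst nn_integral_real_affine[of "\<lambda>t. f (t, \<theta>)" 1 "- phase h (0, \<theta>)"]) (auto simp: algebra_simps)
  qed
  also have "\<dots> = (\<integral>\<^sup>+ s. f s \<partial>line_intensity c)"
    by (rule nn_integral_line_intensity[symmetric]) measurable
  finally show ?thesis .
qed

text \<open>
  Moving the point by \<open>h\<close> has the same effect as moving the line by \<open>- h\<close>.
\<close>

lemma phase_add: "phase (p + h) s = phase p (fst s - phase h (0, snd s), snd s)"
  by (simp add: phase_def algebra_simps)

text \<open>
  For each angle the phase runs through the real line with unit speed as \<open>r\<close> does; the angles contribute the factor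
  \<open>2 \<pi>\<close>.
\<close>

lemma nn_integral_phase:
  assumes [measurable]: "g \<in> borel_measurable borel"
  shows "(\<integral>\<^sup>+ s. g (phase p s) \<partial>line_intensity c) = ennreal c * ennreal (2 * pi) * (\<integral>\<^sup>+ t. g t \<partial>lborel)"
proof -
  have "(\<integral>\<^sup>+ s. g (phase p s) \<partial>line_intensity c) = ennreal c * (\<integral>\<^sup>+ \<theta>. \<integral>\<^sup>+ t. g (phase p (t, \<theta>)) \<partial>lborel \<partial>angle_measure)"
    by (rule nn_integral_line_intensity) measurable
  also have "(\<lambda>\<theta>. \<integral>\<^sup>+ t. g (phase p (t, \<theta>)) \<partial>lborel) = (\<lambda>\<theta>. \<integral>\<^sup>+ t. g t \<partial>lborel)"
  proof
    fix \<theta> :: angle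
    show "(\<integral>\<^sup>+ t. g (phase p (t, \<theta>)) \<partial>lborel) = (\<integral>\<^sup>+ t. g t \<partial>lborel)"
      by (subst nn_integral_real_affine[of g "-1" "phase p (0, \<theta>)"]) (auto simp: phase_def)
  qed
  finally show ?thesis
    by (simp add: emeasure_angle_measure_UNIV mult_ac)
qed

lemma wave_eq: "wave r \<phi> Fs i p \<omega> = Fs i (phase p (r i \<omega>, \<phi> i \<omega>)) \<omega>"
  by (cases p) (simp add: wave_def phase_def)

section \<open>Waves with independent marks\<close>

lemma (in sigma_finite_measure) measurable_emeasure_Collect:
  assumes "{z \<in> space (L \<Otimes>\<^sub>M M). P (fst z) (snd z)} \<in> sets (L \<Otimes>\<^sub>M M)"
  shows "(\<lambda>x. emeasure M {y \<in> space M. P x y}) \<in> borel_measurable L"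
proof (rule measurable_emeasure)
  have "{z \<in> space (L \<Otimes>\<^sub>M M). snd z \<in> {y \<in> space M. P (fst z) y}} = {z \<in> space (L \<Otimes>\<^sub>M M). P (fst z) (snd z)}"
    by (auto simp: space_pair_measure)
  with assms show "{z \<in> space (L \<Otimes>\<^sub>M M). snd z \<in> {y \<in> space M. P (fst z) y}} \<in> sets (L \<Otimes>\<^sub>M M)"
    by simp
qed auto

locale marked_line_process =
  fixes M :: "'w measure" and N :: "'v measure" and lambda :: real
    and r :: "nat \<Rightarrow> 'w \<Rightarrow> real" and \<phi> :: "nat \<Rightarrow> 'w \<Rightarrow> angle"
    and F :: "real \<Rightarrow> 'v \<Rightarrow> real" and Fs :: "nat \<Rightarrow> real \<Rightarrow> 'w \<Rightarrow> real"
  assumes points: "poisson_point_process M (line_intensity lambda) (\<lambda>i \<omega>. (r i \<omega>, \<phi> i \<omega>))"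
    and F_process: "measurable_process N F"
    and F_nonneg: "\<And>t \<omega>. \<omega> \<in> space N \<Longrightarrow> F t \<omega> \<ge> 0"
    and F_tail: "\<And>a. a > 0 \<Longrightarrow> (\<integral>\<^sup>+ t. emeasure N {\<omega> \<in> space N. F t \<omega> > a} \<partial>lborel) < \<infinity>"
    and copies: "iid_copies_indep_of M (line_intensity lambda) (\<lambda>i \<omega>. (r i \<omega>, \<phi> i \<omega>)) N F Fs"
begin

sublocale M: prob_space M
  using points by (simp add: poisson_point_process_def)

sublocale N: prob_space N
  using F_process by (simp add: measurable_process_def)

abbreviation "\<mu> \<equiv> line_intensity lambda"

abbreviation "W \<equiv> wave r \<phi> Fs"

lemma measurable_points [measurable]: "(\<lambda>\<omega>. (r i \<omega>, \<phi> i \<omega>)) \<in> measurable M (borel \<Otimes>\<^sub>M borel)"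
  using points by (simp add: poisson_point_process_def measurable_cong_sets[OF refl sets_line_intensity])

lemma measurable_F_phase [measurable]:
  "(\<lambda>z. F (phase p (fst z)) (snd z)) \<in> borel_measurable ((borel \<Otimes>\<^sub>M borel) \<Otimes>\<^sub>M N)"
proof -
  have "(\<lambda>z. (snd z, phase p (fst z))) \<in> measurable ((borel \<Otimes>\<^sub>M borel) \<Otimes>\<^sub>M N) (N \<Otimes>\<^sub>M borel)"
    by measurable
  from measurable_compose[OF this F_process[unfolded measurable_process_def, THEN conjunct2]]
  show ?thesis by simp
qed

lemma measurable_F [measurable]: "F t \<in> borel_measurable N"
proof -
  have "(\<lambda>\<omega>. (\<omega>, t)) \<in> measurable N (N \<Otimes>\<^sub>M borel)" by measurable
  from measurable_compose[OF this F_process[unfolded measurable_process_def, THEN conjunct2]]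
  show ?thesis by simp
qed

lemma copies_subalgebras:
  "\<exists>A :: nat \<Rightarrow> 'w measure.
     (\<forall>i. space (A i) = space M \<and> sets (A i) \<subseteq> sets M \<and>
        (\<lambda>(\<omega>, t). Fs i t \<omega>) \<in> borel_measurable (A i \<Otimes>\<^sub>M borel)) \<and>
     M.indep_sets (case_option (sets (vimage_algebra (space M) (\<lambda>\<omega> i. (r i \<omega>, \<phi> i \<omega>)) (Pi\<^sub>M UNIV (\<lambda>_. \<mu>))))
           (\<lambda>i. sets (A i))) UNIV"
  using copies unfolding iid_copies_indep_of_def by blast

lemma measurable_copy_process:
  "(\<lambda>(\<omega>, t). Fs i t \<omega>) \<in> borel_measurable (M \<Otimes>\<^sub>M borel)"
proof -
  obtain A :: "nat \<Rightarrow> 'w measure" where A: "\<forall>i. space (A i) = space M \<and> sets (A i) \<subseteq> sets M \<and>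
      (\<lambda>(\<omega>, t). Fs i t \<omega>) \<in> borel_measurable (A i \<Otimes>\<^sub>M borel)"
    using copies_subalgebras by blast
  have "(\<lambda>x. x) \<in> measurable M (A i)"
    using A by (intro measurable_supalgebra[OF measurable_ident_sets[OF refl]]) auto
  then have "(\<lambda>z. (fst z, snd z)) \<in> measurable (M \<Otimes>\<^sub>M borel) (A i \<Otimes>\<^sub>M borel)"
    by measurable
  from measurable_compose[OF this, of "\<lambda>(\<omega>, t). Fs i t \<omega>"] A show ?thesis
    by (simp add: split_beta')
qed

lemma measurable_copies [measurable]: "Fs i t \<in> borel_measurable M"
proof -
  have "(\<lambda>\<omega>. (\<omega>, t)) \<in> measurable M (M \<Otimes>\<^sub>M borel)" by measurable
  from measurable_compose[OF this measurable_copy_process] show ?thesis by simp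
qed

lemma measurable_wave [measurable]: "W i p \<in> borel_measurable M"
proof -
  have "(\<lambda>\<omega>. phase p (r i \<omega>, \<phi> i \<omega>)) \<in> borel_measurable M"
    by (rule measurable_compose[OF measurable_points measurable_phase])
  then have "(\<lambda>\<omega>. (\<omega>, phase p (r i \<omega>, \<phi> i \<omega>))) \<in> measurable M (M \<Otimes>\<^sub>M borel)" by measurable
  from measurable_compose[OF this measurable_copy_process] show ?thesis by (simp add: wave_eq[abs_def])
qed

text \<open>
  The times \<open>\<tau> p\<close> need not be distinct, so the finite-dimensional distributions of \<open>F\<close> and \<open>Fs i\<close> are compared over
  the set of times \<open>\<tau> ` I\<close> and then pulled back to \<open>I\<close>.
\<close>

lemma copy_expectation:
  assumes I: "finite I" and \<Psi>: "\<Psi> \<in> borel_measurable (Pi\<^sub>M I (\<lambda>_. borel))"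
  shows "(\<integral>\<^sup>+ \<omega>. \<Psi> (\<lambda>p\<in>I. Fs i (\<tau> p) \<omega>) \<partial>M) = (\<integral>\<^sup>+ \<nu>. \<Psi> (\<lambda>p\<in>I. F (\<tau> p) \<nu>) \<partial>N)"
proof -
  let ?T = "\<tau> ` I" and ?g = "\<lambda>y. \<lambda>p\<in>I. y (\<tau> p)"
  have g: "?g \<in> measurable (Pi\<^sub>M ?T (\<lambda>_. borel)) (Pi\<^sub>M I (\<lambda>_. borel))"
    by (intro measurable_restrict measurable_component_singleton) auto
  note \<Psi>g = measurable_compose[OF g \<Psi>]
  have "(\<integral>\<^sup>+ \<omega>. \<Psi> (\<lambda>p\<in>I. Fs i (\<tau> p) \<omega>) \<partial>M) = (\<integral>\<^sup>+ y. \<Psi> (?g y) \<partial>fdd M (Fs i) ?T)"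
    unfolding fdd_def using \<Psi>g
    by (subst nn_integral_distr) (auto intro!: nn_integral_cong arg_cong[where f = \<Psi>])
  also have "fdd M (Fs i) ?T = fdd N F ?T"
    using copies I by (auto simp: iid_copies_indep_of_def same_fdds_def)
  also have "(\<integral>\<^sup>+ y. \<Psi> (?g y) \<partial>fdd N F ?T) = (\<integral>\<^sup>+ \<nu>. \<Psi> (\<lambda>p\<in>I. F (\<tau> p) \<nu>) \<partial>N)"
    unfolding fdd_def using \<Psi>g
    by (subst nn_integral_distr) (auto intro!: nn_integral_cong arg_cong[where f = \<Psi>])
  finally show ?thesis .
qed

lemma measurable_F_phases:
  assumes \<Psi>: "\<Psi> \<in> borel_measurable (Pi\<^sub>M I (\<lambda>_. borel))"
  shows "(\<lambda>s. \<integral>\<^sup>+ \<nu>. \<Psi> (\<lambda>p\<in>I. F (phase p s) \<nu>) \<partial>N) \<in> borel_measurable (borel \<Otimes>\<^sub>M borel)"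
proof -
  have "(\<lambda>z. \<lambda>p\<in>I. F (phase p (fst z)) (snd z)) \<in> measurable ((borel \<Otimes>\<^sub>M borel) \<Otimes>\<^sub>M N) (Pi\<^sub>M I (\<lambda>_. borel))"
    by (intro measurable_restrict measurable_F_phase)
  from N.borel_measurable_nn_integral_fst[OF measurable_compose[OF this \<Psi>]]
  show ?thesis by simp
qed

text \<open>
  Averaging over the marks replaces the factor of each wave by \<open>h\<close>, evaluated at its line; then
  \<open>poisson_laplace\<close> applies to \<open>h\<close>.
\<close>

theorem wave_laplace:
  assumes I: "finite I" and \<Psi>: "\<Psi> \<in> borel_measurable (Pi\<^sub>M I (\<lambda>_. borel))" and \<Psi>1: "\<And>x. \<Psi> x \<le> 1"
  shows "(\<integral>\<^sup>+ \<omega>. (INF m. \<Prod>i<m. \<Psi> (\<lambda>p\<in>I. W i p \<omega>)) \<partial>M)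
     = expneg (\<integral>\<^sup>+ s. 1 - (\<integral>\<^sup>+ \<nu>. \<Psi> (\<lambda>p\<in>I. F (phase p s) \<nu>) \<partial>N) \<partial>\<mu>)"
proof -
  obtain A :: "nat \<Rightarrow> 'w measure" where A': "\<forall>i. space (A i) = space M \<and> sets (A i) \<subseteq> sets M \<and>
      (\<lambda>(\<omega>, t). Fs i t \<omega>) \<in> borel_measurable (A i \<Otimes>\<^sub>M borel)"
    and indep: "M.indep_sets (case_option (sets (vimage_algebra (space M) (\<lambda>\<omega> i. (r i \<omega>, \<phi> i \<omega>)) (Pi\<^sub>M UNIV (\<lambda>_. \<mu>))))
           (\<lambda>i. sets (A i))) UNIV"
    using copies_subalgebras by blast
  then have A: "space (A i) = space M" "sets (A i) \<subseteq> sets M"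
    "(\<lambda>(\<omega>, t). Fs i t \<omega>) \<in> borel_measurable (A i \<Otimes>\<^sub>M borel)" for i
    by blast+
  define H where "H i = (\<lambda>(s, \<omega>). \<Psi> (\<lambda>p\<in>I. Fs i (phase p s) \<omega>))" for i
  define h where "h s = (\<integral>\<^sup>+ \<nu>. \<Psi> (\<lambda>p\<in>I. F (phase p s) \<nu>) \<partial>N)" for s
  have H: "H i \<in> borel_measurable (\<mu> \<Otimes>\<^sub>M A i)" for i
  proof -
    have "(\<lambda>z. (snd z, phase p (fst z))) \<in> measurable (\<mu> \<Otimes>\<^sub>M A i) (A i \<Otimes>\<^sub>M borel)" for p
      by measurable
    from measurable_compose[OF this A(3)]
    have "(\<lambda>z. \<lambda>p\<in>I. Fs i (phase p (fst z)) (snd z)) \<in> measurable (\<mu> \<Otimes>\<^sub>M A i) (Pi\<^sub>M I (\<lambda>_. borel))"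
      by (intro measurable_restrict) simp
    from measurable_compose[OF this \<Psi>] show ?thesis by (simp add: H_def split_beta')
  qed
  have hH: "(\<integral>\<^sup>+ \<omega>. H i (s, \<omega>) \<partial>M) = h s" for i s
    unfolding H_def h_def using copy_expectation[OF I \<Psi>, of i "\<lambda>p. phase p s"] by simp
  have h: "h \<in> borel_measurable \<mu>"
    using measurable_F_phases[OF \<Psi>] unfolding h_def by (simp cong: measurable_cong_sets)
  have h1: "h s \<le> 1" for s
  proof -
    have "h s \<le> (\<integral>\<^sup>+ \<nu>. 1 \<partial>N)" unfolding h_def by (intro nn_integral_mono \<Psi>1)
    then show ?thesis by (simp add: N.emeasure_space_1)
  qed
  have XM: "(\<lambda>\<omega>. (r i \<omega>, \<phi> i \<omega>)) \<in> measurable M \<mu>" for i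
    using points by (simp add: poisson_point_process_def)
  have \<Psi>W: "(\<lambda>\<omega>. \<Psi> (\<lambda>p\<in>I. W i p \<omega>)) \<in> borel_measurable M" for i
    by (rule measurable_compose[OF _ \<Psi>]) (intro measurable_restrict measurable_wave)
  have WH: "\<Psi> (\<lambda>p\<in>I. W i p \<omega>) = H i ((r i \<omega>, \<phi> i \<omega>), \<omega>)" for i \<omega>
    by (simp add: H_def wave_eq)
  have "(\<integral>\<^sup>+ \<omega>. (INF m. \<Prod>i<m. \<Psi> (\<lambda>p\<in>I. W i p \<omega>)) \<partial>M) = (INF m. \<integral>\<^sup>+ \<omega>. (\<Prod>i<m. \<Psi> (\<lambda>p\<in>I. W i p \<omega>)) \<partial>M)"
    by (rule nn_integral_INF_prod[OF M.prob_space_axioms \<Psi>W \<Psi>1])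
  also have "\<dots> = (INF m. \<integral>\<^sup>+ \<omega>. (\<Prod>i<m. h (r i \<omega>, \<phi> i \<omega>)) \<partial>M)"
  proof (rule INF_cong)
    fix m
    have "(\<integral>\<^sup>+ \<omega>. (\<Prod>i<m. \<Psi> (\<lambda>p\<in>I. W i p \<omega>)) \<partial>M) = (\<integral>\<^sup>+ \<omega>. 1 * (\<Prod>i<m. H i ((r i \<omega>, \<phi> i \<omega>), \<omega>)) \<partial>M)"
      by (simp add: WH)
    also have "\<dots> = (\<integral>\<^sup>+ \<omega>. 1 * (\<Prod>i<m. \<integral>\<^sup>+ \<omega>'. H i ((r i \<omega>, \<phi> i \<omega>), \<omega>') \<partial>M) \<partial>M)"
      by (rule M.nn_integral_independent_marks[OF XM A(1) A(2) indep H]) simp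
    also have "\<dots> = (\<integral>\<^sup>+ \<omega>. (\<Prod>i<m. h (r i \<omega>, \<phi> i \<omega>)) \<partial>M)"
      by (simp add: hH)
    finally show "(\<integral>\<^sup>+ \<omega>. (\<Prod>i<m. \<Psi> (\<lambda>p\<in>I. W i p \<omega>)) \<partial>M) = (\<integral>\<^sup>+ \<omega>. (\<Prod>i<m. h (r i \<omega>, \<phi> i \<omega>)) \<partial>M)" .
  qed simp
  also have "\<dots> = (\<integral>\<^sup>+ \<omega>. (INF m. \<Prod>i<m. h (r i \<omega>, \<phi> i \<omega>)) \<partial>M)"
    by (rule nn_integral_INF_prod[symmetric, OF M.prob_space_axioms measurable_compose[OF XM h] h1])
  also have "\<dots> = expneg (\<integral>\<^sup>+ s. 1 - h s \<partial>\<mu>)"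
    by (rule poisson_laplace[OF points sigma_finite_line_intensity h h1])
  finally show ?thesis unfolding h_def .
qed

lemma measurable_F_section: "(\<lambda>\<nu>. \<lambda>p\<in>I. F (\<tau> p) \<nu>) \<in> measurable N (Pi\<^sub>M I (\<lambda>_. borel))"
  by (intro measurable_restrict measurable_F)

lemma measurable_wave_section: "(\<lambda>\<omega>. \<lambda>p\<in>I. W i p \<omega>) \<in> measurable M (Pi\<^sub>M I (\<lambda>_. borel))"
  by (intro measurable_restrict measurable_wave)

lemma waves_avoid:
  assumes I: "finite I" and B: "B \<in> sets (Pi\<^sub>M I (\<lambda>_. borel))"
  shows "emeasure M {\<omega> \<in> space M. \<forall>i. (\<lambda>p\<in>I. W i p \<omega>) \<in> B}
     = expneg (\<integral>\<^sup>+ s. emeasure N {\<nu> \<in> space N. (\<lambda>p\<in>I. F (phase p s) \<nu>) \<notin> B} \<partial>\<mu>)"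
proof -
  have BF: "{\<nu> \<in> space N. (\<lambda>p\<in>I. F (phase p s) \<nu>) \<in> B} \<in> sets N" for s
    using measurable_sets[OF measurable_F_section B] by (simp add: vimage_def Int_def conj_commute)
  have BW: "{\<omega> \<in> space M. (\<lambda>p\<in>I. W i p \<omega>) \<in> B} \<in> sets M" for i
    using measurable_sets[OF measurable_wave_section B] by (simp add: vimage_def Int_def conj_commute)
  have compl: "1 - (\<integral>\<^sup>+ \<nu>. indicator B (\<lambda>p\<in>I. F (phase p s) \<nu>) \<partial>N) = emeasure N {\<nu> \<in> space N. (\<lambda>p\<in>I. F (phase p s) \<nu>) \<notin> B}" for s
  proof -
    have "(\<integral>\<^sup>+ \<nu>. indicator B (\<lambda>p\<in>I. F (phase p s) \<nu>) \<partial>N) = (\<integral>\<^sup>+ \<nu>. indicator {\<nu> \<in> space N. (\<lambda>p\<in>I. F (phase p s) \<nu>) \<in> B} \<nu> \<partial>N)"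
      by (intro nn_integral_cong) (auto simp: indicator_def)
    also have "\<dots> = emeasure N {\<nu> \<in> space N. (\<lambda>p\<in>I. F (phase p s) \<nu>) \<in> B}"
      by (rule nn_integral_indicator[OF BF])
    finally show ?thesis
      using N.prob_neg[OF BF[of s]] by (simp add: N.emeasure_eq_measure ennreal_minus flip: ennreal_1)
  qed
  have "emeasure M {\<omega> \<in> space M. \<forall>i. (\<lambda>p\<in>I. W i p \<omega>) \<in> B} = (\<integral>\<^sup>+ \<omega>. indicator {\<omega> \<in> space M. \<forall>i. (\<lambda>p\<in>I. W i p \<omega>) \<in> B} \<omega> \<partial>M)"
    using BW by (intro nn_integral_indicator[symmetric] sets.sets_Collect_countable_All)
  also have "\<dots> = (\<integral>\<^sup>+ \<omega>. (INF m. \<Prod>i<m. indicator B (\<lambda>p\<in>I. W i p \<omega>)) \<partial>M)"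
    by (intro nn_integral_cong, subst INF_prod_indicator) (auto simp: indicator_def)
  also have "\<dots> = expneg (\<integral>\<^sup>+ s. 1 - (\<integral>\<^sup>+ \<nu>. indicator B (\<lambda>p\<in>I. F (phase p s) \<nu>) \<partial>N) \<partial>\<mu>)"
    by (rule wave_laplace[OF I borel_measurable_indicator[OF B]]) (simp add: indicator_def)
  finally show ?thesis unfolding compl .
qed

text \<open>
  Since \<open>F\<close> is nonnegative, the set of negative values is avoided with probability \<open>exp (- 0)\<close>.
\<close>

lemma waves_nonneg: "AE \<omega> in M. \<forall>i. 0 \<le> W i p \<omega>"
proof -
  have B: "{x \<in> space (Pi\<^sub>M {p} (\<lambda>_. borel)). 0 \<le> (x p :: real)} \<in> sets (Pi\<^sub>M {p} (\<lambda>_. borel))" by measurable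
  have E: "{\<nu> \<in> space N. (\<lambda>p\<in>{p}. F (phase p s) \<nu>) \<notin> {x \<in> space (Pi\<^sub>M {p} (\<lambda>_. borel)). 0 \<le> (x p :: real)}} = {}" for s
    using F_nonneg by (auto simp: space_PiM)
  have "emeasure M {\<omega> \<in> space M. \<forall>i. 0 \<le> W i p \<omega>} = 1"
    using waves_avoid[OF _ B] unfolding E by (simp add: space_PiM)
  moreover have "{\<omega> \<in> space M. \<forall>i. 0 \<le> W i p \<omega>} \<in> sets M" by measurable
  ultimately show ?thesis by (simp add: M.emeasure_eq_measure M.prob_Collect_eq_1)
qed

text \<open>
  The intensity, in other words the expected number, of waves that exceed the threshold \<open>a p\<close> at some point
  \<open>p \<in> I\<close>.
\<close>

definition excess :: "(real \<times> real) set \<Rightarrow> (real \<times> real \<Rightarrow> real) \<Rightarrow> ennreal" where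
  "excess I a = (\<integral>\<^sup>+ s. emeasure N {\<nu> \<in> space N. \<exists>p\<in>I. a p < F (phase p s) \<nu>} \<partial>\<mu>)"

lemma waves_below:
  assumes I: "finite I"
  shows "emeasure M {\<omega> \<in> space M. \<forall>i. \<forall>p\<in>I. W i p \<omega> \<le> a p} = expneg (excess I a)"
proof -
  let ?B = "{f \<in> I \<rightarrow>\<^sub>E UNIV. \<forall>p\<in>I. f p \<le> a p}"
  have "{\<nu> \<in> space N. (\<lambda>p\<in>I. F (phase p s) \<nu>) \<notin> ?B} = {\<nu> \<in> space N. \<exists>p\<in>I. a p < F (phase p s) \<nu>}" for s
    by (auto simp: not_le)
  moreover have "{\<omega> \<in> space M. \<forall>i. (\<lambda>p\<in>I. W i p \<omega>) \<in> ?B} = {\<omega> \<in> space M. \<forall>i. \<forall>p\<in>I. W i p \<omega> \<le> a p}"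
    by auto
  ultimately show ?thesis
    using waves_avoid[OF I lower_box_measurable[OF I order_refl, of a]] by (simp add: excess_def)
qed

lemma measurable_excess:
  assumes "finite I"
  shows "(\<lambda>s. emeasure N {\<nu> \<in> space N. \<exists>p\<in>I. a p < F (phase p s) \<nu>}) \<in> borel_measurable (borel \<Otimes>\<^sub>M borel)"
  by (rule N.measurable_emeasure_Collect) (intro sets.sets_Collect_finite_Ex assms, measurable)

section \<open>The maximum is attained\<close>

lemma tail_phase:
  "(\<integral>\<^sup>+ s. emeasure N {\<nu> \<in> space N. a < F (phase p s) \<nu>} \<partial>\<mu>)
    = ennreal lambda * ennreal (2 * pi) * (\<integral>\<^sup>+ t. emeasure N {\<nu> \<in> space N. a < F t \<nu>} \<partial>lborel)"
proof (rule nn_integral_phase)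
  have "(\<lambda>(t, \<nu>). F t \<nu>) \<in> borel_measurable (borel \<Otimes>\<^sub>M N)"
  proof -
    have "(\<lambda>z. (snd z, fst z)) \<in> measurable (borel \<Otimes>\<^sub>M N) (N \<Otimes>\<^sub>M borel)" by measurable
    from measurable_compose[OF this F_process[unfolded measurable_process_def, THEN conjunct2]]
    show ?thesis by (simp add: split_beta')
  qed
  then have "{z \<in> space (borel \<Otimes>\<^sub>M N). a < F (fst z) (snd z)} \<in> sets (borel \<Otimes>\<^sub>M N)"
    by (simp add: split_beta')
  then show "(\<lambda>t. emeasure N {\<nu> \<in> space N. a < F t \<nu>}) \<in> borel_measurable borel"
    by (rule N.measurable_emeasure_Collect)
qed

text \<open>
  Each wave above \<open>a\<close> is given the factor \<open>z < 1\<close>. The product of the factors is at most the indicator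
  of the event in question, and its expectation \<open>exp (- (1 - z) v)\<close> tends to \<open>1\<close> as \<open>z\<close> tends to \<open>1\<close>.
\<close>

lemma finitely_many_high_waves:
  assumes a: "a > 0"
  shows "AE \<omega> in M. finite {i. a < W i p \<omega>}"
proof -
  let ?q = "\<lambda>s. emeasure N {\<nu> \<in> space N. a < F (phase p s) \<nu>}"
  define v where "v = (\<integral>\<^sup>+ s. ?q s \<partial>\<mu>)"
  have v: "v < \<infinity>"
    unfolding v_def tail_phase using F_tail[OF a] by (simp add: ennreal_mult_less_top)
  have fin_meas: "{\<omega> \<in> space M. finite {i. a < W i p \<omega>}} \<in> sets M"
  proof -
    have "finite {i. a < W i p \<omega>} \<longleftrightarrow> (\<exists>m. \<forall>i. m \<le> i \<longrightarrow> W i p \<omega> \<le> a)" for \<omega>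
      by (simp only: finite_nat_iff_bounded subset_iff mem_Collect_eq lessThan_iff) (meson not_less)
    moreover have "{\<omega> \<in> space M. \<exists>m. \<forall>i. m \<le> i \<longrightarrow> W i p \<omega> \<le> a} \<in> sets M"
      by measurable
    ultimately show ?thesis by simp
  qed
  have bound: "expneg (ennreal (1 - z) * v) \<le> emeasure M {\<omega> \<in> space M. finite {i. a < W i p \<omega>}}"
    if z: "0 \<le> z" "z < 1" for z :: real
  proof -
    \<comment> \<open>\<open>wave_laplace\<close> is applied to \<open>\<Psi> x = z\<close> if \<open>a < x p\<close> and \<open>\<Psi> x = 1\<close> otherwise.\<close>
    let ?B = "{x \<in> space (Pi\<^sub>M {p} (\<lambda>_. borel)). a < (x p :: real)}"
    let ?\<Psi> = "\<lambda>x. if x \<in> ?B then ennreal z else 1"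
    have B: "?B \<in> sets (Pi\<^sub>M {p} (\<lambda>_. borel))" by measurable
    have \<Psi>: "?\<Psi> \<in> borel_measurable (Pi\<^sub>M {p} (\<lambda>_. borel))"
      using B by (intro measurable_If_set) auto
    have \<Psi>1: "?\<Psi> x \<le> 1" for x using z by auto
    have q: "1 - (\<integral>\<^sup>+ \<nu>. ?\<Psi> (\<lambda>p\<in>{p}. F (phase p s) \<nu>) \<partial>N) = ennreal (1 - z) * ?q s" for s
    proof -
      let ?E = "{\<nu> \<in> space N. a < F (phase p s) \<nu>}"
      have E: "?E \<in> sets N" by measurable
      have "(\<integral>\<^sup>+ \<nu>. ?\<Psi> (\<lambda>p\<in>{p}. F (phase p s) \<nu>) \<partial>N)
          = (\<integral>\<^sup>+ \<nu>. ennreal z * indicator ?E \<nu> + indicator (space N - ?E) \<nu> \<partial>N)"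
        by (intro nn_integral_cong) (auto simp: space_PiM indicator_def)
      also have "\<dots> = ennreal z * emeasure N ?E + emeasure N (space N - ?E)"
        using E by (subst nn_integral_add) (auto simp: nn_integral_cmult)
      also have "\<dots> = ennreal (1 - (1 - z) * N.prob ?E)"
        using E z by (simp add: N.emeasure_eq_measure N.prob_compl algebra_simps flip: ennreal_mult ennreal_plus)
      finally show ?thesis
        using z by (simp add: N.emeasure_eq_measure ennreal_minus mult_le_one flip: ennreal_1 ennreal_mult)
    qed
    have "expneg (ennreal (1 - z) * v) = expneg (\<integral>\<^sup>+ s. ennreal (1 - z) * ?q s \<partial>\<mu>)"
    proof -
      have "?q \<in> borel_measurable \<mu>"
        using measurable_excess[of "{p}" "\<lambda>_. a"] by (simp cong: measurable_cong_sets)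
      then show ?thesis unfolding v_def by (simp add: nn_integral_cmult)
    qed
    also have "\<dots> = (\<integral>\<^sup>+ \<omega>. (INF m. \<Prod>i<m. ?\<Psi> (\<lambda>p\<in>{p}. W i p \<omega>)) \<partial>M)"
      unfolding q[symmetric] by (rule wave_laplace[symmetric, OF _ \<Psi> \<Psi>1]) simp
    also have "\<dots> \<le> (\<integral>\<^sup>+ \<omega>. indicator {\<omega> \<in> space M. finite {i. a < W i p \<omega>}} \<omega> \<partial>M)"
    proof (rule nn_integral_mono)
      fix \<omega> assume "\<omega> \<in> space M"
      have "(INF m. \<Prod>i<m. ?\<Psi> (\<lambda>p\<in>{p}. W i p \<omega>)) = (INF m. \<Prod>i<m. if i \<in> {i. a < W i p \<omega>} then ennreal z else 1)"
        by (simp add: space_PiM)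
      moreover have "(INF m. \<Prod>i<m. if i \<in> {i. a < W i p \<omega>} then ennreal z else 1) \<le> 1"
        by (rule INF_lower2[of 0]) auto
      ultimately show "(INF m. \<Prod>i<m. ?\<Psi> (\<lambda>p\<in>{p}. W i p \<omega>)) \<le> indicator {\<omega> \<in> space M. finite {i. a < W i p \<omega>}} \<omega>"
        using INF_prod_infinitely_often[of "{i. a < W i p \<omega>}" z] z \<open>\<omega> \<in> space M\<close>
        by (cases "finite {i. a < W i p \<omega>}") (auto simp: indicator_def)
    qed
    finally show ?thesis using fin_meas by simp
  qed
  have "(\<lambda>k. expneg (ennreal (1 - (1 - 1 / real (Suc k))) * v)) \<longlonglongrightarrow> expneg (ennreal 0 * v)"
  proof (intro tendsto_expneg tendsto_mult_ennreal tendsto_const tendsto_ennrealI)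
    show "(\<lambda>k. 1 - (1 - 1 / real (Suc k))) \<longlonglongrightarrow> 0"
      using LIMSEQ_inverse_real_of_nat by (simp add: inverse_eq_divide)
  qed (use v in auto)
  then have "expneg (ennreal 0 * v) \<le> emeasure M {\<omega> \<in> space M. finite {i. a < W i p \<omega>}}"
    by (rule LIMSEQ_le_const2, intro exI allI impI bound) (auto simp: field_simps)
  then have "1 \<le> M.prob {\<omega> \<in> space M. finite {i. a < W i p \<omega>}}"
    by (simp add: M.emeasure_eq_measure)
  then have "M.prob {\<omega> \<in> space M. finite {i. a < W i p \<omega>}} = 1"
    using M.prob_le_1 by (intro antisym) auto
  then show ?thesis using fin_meas by (simp add: M.prob_Collect_eq_1)
qed

lemma maximal_wave: "AE \<omega> in M. \<exists>i. \<forall>j. W j p \<omega> \<le> W i p \<omega>"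
proof -
  have "AE \<omega> in M. \<forall>k. finite {i. 1 / real (Suc k) < W i p \<omega>}"
    unfolding AE_all_countable by (intro allI finitely_many_high_waves) simp
  with waves_nonneg[of p] show ?thesis
  proof eventually_elim
    case (elim \<omega>)
    then show ?case by (intro maximum_attained) blast+
  qed
qed

section \<open>Distribution functions and stationarity\<close>

abbreviation "\<eta> \<equiv> eta r \<phi> Fs"

lemma measurable_eta [measurable]: "\<eta> p \<in> borel_measurable M"
  unfolding eta_def[abs_def] by (intro borel_measurable_real_SUP measurable_wave)

lemma stochastic_process_eta: "stochastic_process M \<eta>"
  by (simp add: stochastic_process_def M.prob_space_axioms)

lemma eta_nonneg: "AE \<omega> in M. 0 \<le> \<eta> p \<omega>"
  using maximal_wave[of p] waves_nonneg[of p]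
proof eventually_elim
  case (elim \<omega>)
  then have "bdd_above (range (\<lambda>i. W i p \<omega>))" by (auto simp: bdd_above_def)
  then show ?case unfolding eta_def using elim(2) by (intro cSUP_upper2[where x = 0]) auto
qed

text \<open>
  As the maximum is attained, the real supremum that defines \<open>\<eta>\<close> is almost surely that of a bounded set.
\<close>

lemma eta_cdf:
  assumes I: "finite I"
  shows "emeasure M {\<omega> \<in> space M. \<forall>p\<in>I. \<eta> p \<omega> \<le> a p} = expneg (excess I a)"
proof -
  have "AE \<omega> in M. \<forall>p\<in>I. \<exists>i. \<forall>j. W j p \<omega> \<le> W i p \<omega>"
    using I by (intro AE_finite_allI maximal_wave)
  then have "AE \<omega> in M. (\<forall>p\<in>I. \<eta> p \<omega> \<le> a p) \<longleftrightarrow> (\<forall>i. \<forall>p\<in>I. W i p \<omega> \<le> a p)"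
    by eventually_elim (auto simp: eta_def real_SUP_le_iff)
  then have "emeasure M {\<omega> \<in> space M. \<forall>p\<in>I. \<eta> p \<omega> \<le> a p} = emeasure M {\<omega> \<in> space M. \<forall>i. \<forall>p\<in>I. W i p \<omega> \<le> a p}"
  proof (intro emeasure_eq_AE)
    show "{\<omega> \<in> space M. \<forall>p\<in>I. \<eta> p \<omega> \<le> a p} \<in> sets M"
      by (intro sets.sets_Collect_finite_All I) measurable
    show "{\<omega> \<in> space M. \<forall>i. \<forall>p\<in>I. W i p \<omega> \<le> a p} \<in> sets M"
      by (intro sets.sets_Collect_countable_All sets.sets_Collect_finite_All I) measurable
  qed auto
  then show ?thesis using waves_below[OF I] by simp
qed

lemma excess_translate:
  assumes I: "finite I"
  shows "excess ((\<lambda>p. p + h) ` I) (\<lambda>q. a (q - h)) = excess I a"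
proof -
  have "excess ((\<lambda>p. p + h) ` I) (\<lambda>q. a (q - h))
      = (\<integral>\<^sup>+ s. emeasure N {\<nu> \<in> space N. \<exists>p\<in>I. a p < F (phase p (fst s - phase h (0, snd s), snd s)) \<nu>} \<partial>\<mu>)"
    unfolding excess_def by (simp add: phase_add)
  also have "\<dots> = excess I a"
    unfolding excess_def by (rule nn_integral_line_intensity_shift[OF measurable_excess[OF I]])
  finally show ?thesis .
qed

theorem stationary_eta: "stationary M \<eta>"
  unfolding stationary_def
proof (intro conjI allI stochastic_process_eta)
  fix h
  show "same_fdds M (\<lambda>p. \<eta> (p + h)) M \<eta>"
  proof (rule same_fdds_cdfI[OF _ stochastic_process_eta eta_nonneg eta_nonneg])
    show "stochastic_process M (\<lambda>p. \<eta> (p + h))"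
      by (simp add: stochastic_process_def M.prob_space_axioms)
    fix J :: "(real \<times> real) set" and a :: "real \<times> real \<Rightarrow> real" assume J: "finite J"
    have "{\<omega> \<in> space M. \<forall>p\<in>J. \<eta> (p + h) \<omega> \<le> a p} = {\<omega> \<in> space M. \<forall>q\<in>(\<lambda>p. p + h) ` J. \<eta> q \<omega> \<le> a (q - h)}"
      by auto
    then have "emeasure M {\<omega> \<in> space M. \<forall>p\<in>J. \<eta> (p + h) \<omega> \<le> a p} = expneg (excess ((\<lambda>p. p + h) ` J) (\<lambda>q. a (q - h)))"
      using eta_cdf[of "(\<lambda>p. p + h) ` J" "\<lambda>q. a (q - h)"] J by simp
    then show "emeasure M {\<omega> \<in> space M. \<forall>p\<in>J. \<eta> (p + h) \<omega> \<le> a p} = emeasure M {\<omega> \<in> space M. \<forall>p\<in>J. \<eta> p \<omega> \<le> a p}"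
      by (simp add: excess_translate J eta_cdf)
  qed
qed

end

section \<open>Colouring the waves\<close>

lemma (in sequence_space) emeasure_PiM_countable_INF:
  fixes B :: "nat \<Rightarrow> 'a set" assumes B: "\<And>i. B i \<in> sets M"
  shows "emeasure S (Pi UNIV B) = (INF m. \<Prod>i<m. emeasure M (B i))"
proof (rule LIMSEQ_unique)
  have "(\<lambda>m. ennreal (\<Prod>i\<le>m. measure M (B i))) \<longlonglongrightarrow> ennreal (measure S (Pi UNIV B))"
    by (intro tendsto_ennrealI measure_PiM_countable B)
  also have "(\<lambda>m. ennreal (\<Prod>i\<le>m. measure M (B i))) = (\<lambda>m. \<Prod>i<Suc m. emeasure M (B i))"
    by (simp only: M.emeasure_eq_measure prod_ennreal measure_nonneg lessThan_Suc_atMost)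
  finally show "(\<lambda>m. \<Prod>i<Suc m. emeasure M (B i)) \<longlonglongrightarrow> emeasure S (Pi UNIV B)"
    by (simp only: P.emeasure_eq_measure)
  have "decseq (\<lambda>m. \<Prod>i<m. emeasure M (B i))"
    by (intro decseq_prod_le_1 M.emeasure_le_1)
  then have "(\<lambda>m. \<Prod>i<m. emeasure M (B i)) \<longlonglongrightarrow> (INF m. \<Prod>i<m. emeasure M (B i))"
    by (rule LIMSEQ_INF)
  then show "(\<lambda>m. \<Prod>i<Suc m. emeasure M (B i)) \<longlonglongrightarrow> (INF m. \<Prod>i<m. emeasure M (B i))"
    by (rule LIMSEQ_Suc)
qed

lemma AE_pair_fst:
  assumes "prob_space K" and P: "AE \<omega> in M. P \<omega>"
  shows "AE w in M \<Otimes>\<^sub>M K. P (fst w)"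
proof -
  interpret K: prob_space K by fact
  have "AE \<omega> in distr (M \<Otimes>\<^sub>M K) M fst. P \<omega>"
    unfolding K.distr_pair_fst by (rule P)
  then show ?thesis by (rule AE_distrD[OF measurable_fst])
qed

context marked_line_process
begin

definition colours :: "nat \<Rightarrow> (nat \<Rightarrow> nat) measure" where
  "colours n = Pi\<^sub>M UNIV (\<lambda>_. measure_pmf (pmf_of_set {..<n}))"

text \<open>
  Waves of other colours are replaced by \<open>0\<close>, which does not affect the supremum of nonnegative values
  and gives it the value \<open>0\<close> when no wave has colour \<open>k\<close>.
\<close>

definition thinned :: "nat \<Rightarrow> real \<times> real \<Rightarrow> 'w \<times> (nat \<Rightarrow> nat) \<Rightarrow> real" where
  "thinned k p w = (SUP i. if snd w i = k then W i p (fst w) else 0)"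

lemma prob_space_colours: "prob_space (colours n)"
  unfolding colours_def by (intro prob_space_PiM prob_space_measure_pmf)

lemma measurable_colour [measurable]: "(\<lambda>\<kappa>. \<kappa> i) \<in> measurable (colours n) (count_space UNIV)"
proof -
  have "(\<lambda>\<kappa>. \<kappa> i) \<in> measurable (colours n) (measure_pmf (pmf_of_set {..<n}))"
    unfolding colours_def by (rule measurable_component_singleton) simp
  then show ?thesis by (simp cong: measurable_cong_sets)
qed

lemma measurable_thinned [measurable]: "thinned k p \<in> borel_measurable (M \<Otimes>\<^sub>M colours n)"
  unfolding thinned_def[abs_def]
proof (rule borel_measurable_real_SUP)
  fix i
  have [measurable]: "(\<lambda>w. snd w i) \<in> measurable (M \<Otimes>\<^sub>M colours n) (count_space UNIV)"
    by (rule measurable_compose[OF measurable_snd measurable_colour])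
  show "(\<lambda>w. if snd w i = k then W i p (fst w) else 0) \<in> borel_measurable (M \<Otimes>\<^sub>M colours n)"
    by measurable
qed

lemma thinned_nonneg: "AE w in M \<Otimes>\<^sub>M colours n. 0 \<le> thinned k p w"
  using AE_pair_fst[OF prob_space_colours maximal_wave[of p]] AE_pair_fst[OF prob_space_colours waves_nonneg[of p]]
  by eventually_elim (unfold thinned_def, rule real_SUP_restricted_nonneg)

text \<open>
  For fixed waves the colours are independent, and the conditional probability that all waves respect the
  thresholds of their own colour is the product over the waves of \<open>\<Psi> (W i p)\<^sub>p\<^sub>\<in>\<^sub>I\<close>. Here \<open>\<Psi> x\<close> is the
  proportion of the colours whose thresholds the values \<open>x\<close> respect, and \<open>1 - \<Psi>\<close> averages to the mean of the \<open>n\<close>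
  probabilities of exceeding them.
\<close>

lemma thinned_joint_cdf:
  assumes n: "n \<ge> 1" and J: "\<And>k. k < n \<Longrightarrow> finite (J k)"
    and a: "\<And>k p. k < n \<Longrightarrow> p \<in> J k \<Longrightarrow> 0 \<le> a k p"
  shows "emeasure (M \<Otimes>\<^sub>M colours n) {w \<in> space (M \<Otimes>\<^sub>M colours n). \<forall>k<n. \<forall>p\<in>J k. thinned k p w \<le> a k p}
    = (\<Prod>k<n. expneg (excess (J k) (a k) / of_nat n))"
proof -
  let ?U = "measure_pmf (pmf_of_set {..<n})"
  let ?M' = "M \<Otimes>\<^sub>M colours n"
  interpret K: sequence_space ?U ..
  interpret C: prob_space "colours n" by (rule prob_space_colours)
  define I where "I = (\<Union>k<n. J k)"
  have I: "finite I" unfolding I_def using J by auto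
  define C where "C k = {f \<in> I \<rightarrow>\<^sub>E UNIV. \<forall>p\<in>J k. f p \<le> a k p}" for k
  have JI: "J k \<subseteq> I" if "k < n" for k using that by (auto simp: I_def)
  have C: "C k \<in> sets (Pi\<^sub>M I (\<lambda>_. borel))" if "k < n" for k
    unfolding C_def by (rule lower_box_measurable[OF J[OF that] JI[OF that]])
  define \<Psi> :: "(real \<times> real \<Rightarrow> real) \<Rightarrow> ennreal" where "\<Psi> x = (\<Sum>k<n. indicator (C k) x) / of_nat n" for x
  have \<Psi>: "\<Psi> \<in> borel_measurable (Pi\<^sub>M I (\<lambda>_. borel))"
    unfolding \<Psi>_def using C by (intro borel_measurable_divide_ennreal borel_measurable_sum) auto
  \<comment> \<open>The colours that the \<open>i\<close>-th wave may have; only the colours below \<open>n\<close> have positive probability.\<close>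
  define B where "B \<omega> i = {k. k < n \<longrightarrow> (\<lambda>p\<in>I. W i p \<omega>) \<in> C k}" for \<omega> i
  have UB: "emeasure ?U {k. k < n \<longrightarrow> x \<in> C k} = \<Psi> x" for x
  proof -
    have "emeasure ?U {k. k < n \<longrightarrow> x \<in> C k} = (\<integral>\<^sup>+ k. indicator {k. k < n \<longrightarrow> x \<in> C k} k \<partial>?U)"
      by simp
    also have "\<dots> = (\<Sum>k<n. indicator {k. k < n \<longrightarrow> x \<in> C k} k) / of_nat n"
      using n by (subst nn_integral_pmf_of_set) (auto simp: lessThan_empty_iff)
    also have "(\<Sum>k<n. indicator {k. k < n \<longrightarrow> x \<in> C k} k :: ennreal) = (\<Sum>k<n. indicator (C k) x)"
      by (intro sum.cong) (auto simp: indicator_def)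
    finally show ?thesis by (simp add: \<Psi>_def)
  qed
  have \<Psi>1: "\<Psi> x \<le> 1" for x unfolding UB[symmetric] by (rule measure_pmf.emeasure_le_1)
  let ?E = "{w \<in> space ?M'. \<forall>i. \<forall>k\<in>{..<n}. \<forall>p\<in>J k. snd w i = k \<longrightarrow> W i p (fst w) \<le> a k p}"
  let ?T = "{w \<in> space ?M'. \<forall>k\<in>{..<n}. \<forall>p\<in>J k. thinned k p w \<le> a k p}"
  have sndw [measurable]: "(\<lambda>w. snd w i) \<in> measurable ?M' (count_space UNIV)" for i
    by (rule measurable_compose[OF measurable_snd measurable_colour])
  have E: "?E \<in> sets ?M'"
    using J by (intro sets.sets_Collect_countable_All sets.sets_Collect_finite_All) (auto, measurable)
  have T: "?T \<in> sets ?M'"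
    using J by (intro sets.sets_Collect_finite_All) auto
  have "AE w in ?M'. \<forall>k\<in>{..<n}. \<forall>p\<in>J k. \<exists>i. \<forall>j. W j p (fst w) \<le> W i p (fst w)"
    using J by (intro AE_finite_allI AE_pair_fst[OF prob_space_colours] maximal_wave) auto
  then have "AE w in ?M'. w \<in> ?T \<longleftrightarrow> w \<in> ?E"
  proof eventually_elim
    case (elim w)
    then have "thinned k p w \<le> a k p \<longleftrightarrow> (\<forall>i. snd w i = k \<longrightarrow> W i p (fst w) \<le> a k p)" if "k < n" "p \<in> J k" for k p
      unfolding thinned_def using that a by (intro real_SUP_restricted_le_iff) auto
    then show ?case by auto
  qed
  then have "emeasure ?M' ?T = emeasure ?M' ?E"
    using T E by (intro emeasure_eq_AE)
  also have "\<dots> = (\<integral>\<^sup>+ \<omega>. emeasure (colours n) (Pair \<omega> -` ?E) \<partial>M)"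
    by (rule C.emeasure_pair_measure_alt[OF E])
  also have "\<dots> = (\<integral>\<^sup>+ \<omega>. (INF m. \<Prod>i<m. \<Psi> (\<lambda>p\<in>I. W i p \<omega>)) \<partial>M)"
  proof (rule nn_integral_cong)
    fix \<omega> assume \<omega>: "\<omega> \<in> space M"
    have "Pair \<omega> -` ?E = Pi UNIV (B \<omega>)"
      using \<omega> JI by (auto simp: space_pair_measure colours_def space_PiM B_def C_def Pi_iff subset_eq)
    then have "emeasure (colours n) (Pair \<omega> -` ?E) = emeasure (Pi\<^sub>M UNIV (\<lambda>_. ?U)) (Pi UNIV (B \<omega>))"
      by (simp add: colours_def)
    also have "\<dots> = (INF m. \<Prod>i<m. emeasure ?U (B \<omega> i))"
      by (rule K.emeasure_PiM_countable_INF) simp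
    also have "\<dots> = (INF m. \<Prod>i<m. \<Psi> (\<lambda>p\<in>I. W i p \<omega>))"
      unfolding B_def UB ..
    finally show "emeasure (colours n) (Pair \<omega> -` ?E) = (INF m. \<Prod>i<m. \<Psi> (\<lambda>p\<in>I. W i p \<omega>))" .
  qed
  also have "\<dots> = expneg (\<integral>\<^sup>+ s. 1 - (\<integral>\<^sup>+ \<nu>. \<Psi> (\<lambda>p\<in>I. F (phase p s) \<nu>) \<partial>N) \<partial>\<mu>)"
    by (rule wave_laplace[OF I \<Psi> \<Psi>1])
  also have "(\<integral>\<^sup>+ s. 1 - (\<integral>\<^sup>+ \<nu>. \<Psi> (\<lambda>p\<in>I. F (phase p s) \<nu>) \<partial>N) \<partial>\<mu>)
      = (\<integral>\<^sup>+ s. (\<Sum>k<n. emeasure N {\<nu> \<in> space N. \<exists>p\<in>J k. a k p < F (phase p s) \<nu>} / of_nat n) \<partial>\<mu>)"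
  proof (rule nn_integral_cong)
    fix s
    let ?e = "\<lambda>k. {\<nu> \<in> space N. \<exists>p\<in>J k. a k p < F (phase p s) \<nu>}"
    have e: "?e k \<in> sets N" if "k < n" for k
      using J[OF that] by (intro sets.sets_Collect_finite_Ex) auto
    have CF: "(\<integral>\<^sup>+ \<nu>. indicator (C k) (\<lambda>p\<in>I. F (phase p s) \<nu>) \<partial>N) = ennreal (1 - N.prob (?e k))" if k: "k < n" for k
    proof -
      have "(\<integral>\<^sup>+ \<nu>. indicator (C k) (\<lambda>p\<in>I. F (phase p s) \<nu>) \<partial>N) = (\<integral>\<^sup>+ \<nu>. indicator (space N - ?e k) \<nu> \<partial>N)"
        using JI[OF k] by (intro nn_integral_cong) (auto simp: C_def indicator_def not_less subset_eq not_le)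
      also have "\<dots> = emeasure N (space N - ?e k)"
        using e[OF k] by (intro nn_integral_indicator) auto
      finally show ?thesis using e[OF k] by (simp add: N.emeasure_eq_measure N.prob_compl)
    qed
    have CFm: "(\<lambda>\<nu>. indicator (C k) (\<lambda>p\<in>I. F (phase p s) \<nu>) :: ennreal) \<in> borel_measurable N" if "k < n" for k
      by (rule measurable_compose[OF measurable_F_section borel_measurable_indicator[OF C[OF that]]])
    \<comment> \<open>The mean probability of exceeding the thresholds of a colour.\<close>
    define y where "y = (\<Sum>k<n. N.prob (?e k) / real n)"
    have "y \<le> (\<Sum>k<n. 1 / real n)"
      unfolding y_def by (intro sum_mono divide_right_mono N.prob_le_1) simp
    then have y: "0 \<le> y" "y \<le> 1" using n by (auto simp: y_def intro!: sum_nonneg)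
    have "(\<integral>\<^sup>+ \<nu>. \<Psi> (\<lambda>p\<in>I. F (phase p s) \<nu>) \<partial>N) = (\<Sum>k<n. \<integral>\<^sup>+ \<nu>. indicator (C k) (\<lambda>p\<in>I. F (phase p s) \<nu>) \<partial>N) / of_nat n"
      unfolding \<Psi>_def using CFm
      by (subst nn_integral_divide) (auto intro!: nn_integral_sum borel_measurable_sum arg_cong2[where f = "(/)"])
    also have "\<dots> = (\<Sum>k<n. ennreal (1 - N.prob (?e k))) / of_nat n"
      by (simp add: CF)
    also have "\<dots> = ennreal ((\<Sum>k<n. 1 - N.prob (?e k)) / real n)"
      using n by (simp add: divide_ennreal sum_nonneg ennreal_of_nat_eq_real_of_nat)
    also have "(\<Sum>k<n. 1 - N.prob (?e k)) / real n = 1 - y"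
      using n by (simp add: y_def sum_subtractf diff_divide_distrib sum_divide_distrib)
    finally have mean: "(\<integral>\<^sup>+ \<nu>. \<Psi> (\<lambda>p\<in>I. F (phase p s) \<nu>) \<partial>N) = ennreal (1 - y)" .
    have "1 - (\<integral>\<^sup>+ \<nu>. \<Psi> (\<lambda>p\<in>I. F (phase p s) \<nu>) \<partial>N) = ennreal y"
      unfolding mean using y by (simp add: ennreal_minus flip: ennreal_1)
    also have "\<dots> = (\<Sum>k<n. emeasure N (?e k) / of_nat n)"
      using n by (simp add: y_def N.emeasure_eq_measure divide_ennreal ennreal_of_nat_eq_real_of_nat)
    finally show "1 - (\<integral>\<^sup>+ \<nu>. \<Psi> (\<lambda>p\<in>I. F (phase p s) \<nu>) \<partial>N) = (\<Sum>k<n. emeasure N (?e k) / of_nat n)" .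
  qed
  also have "\<dots> = (\<Sum>k<n. excess (J k) (a k) / of_nat n)"
  proof -
    have "(\<lambda>s. emeasure N {\<nu> \<in> space N. \<exists>p\<in>J k. a k p < F (phase p s) \<nu>}) \<in> borel_measurable \<mu>" if "k < n" for k
      using measurable_excess[OF J[OF that], of "a k"] by (simp cong: measurable_cong_sets)
    then show ?thesis
      unfolding excess_def by (subst nn_integral_sum) (auto simp: nn_integral_divide)
  qed
  finally show ?thesis by (simp add: expneg_sum Ball_def)
qed

theorem max_id_eta: "max_id M \<eta>"
  unfolding max_id_def
proof (intro conjI allI impI stochastic_process_eta)
  fix n :: nat assume n: "n \<ge> 1"
  interpret K: prob_space "colours n" by (rule prob_space_colours)
  interpret P: pair_prob_space M "colours n" ..
  show "\<exists>(N :: (nat \<Rightarrow> real \<times> real \<Rightarrow> real) measure) Y. prob_space N \<and> iid_processes N n Y \<and>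
        same_fdds M \<eta> N (\<lambda>t \<omega>. MAX k\<in>{..<n}. Y k t \<omega>)"
  proof (rule iid_decomposition[where M' = "M \<Otimes>\<^sub>M colours n" and Z = thinned
        and G = "\<lambda>J a. expneg (excess J a / of_nat n)", OF n stochastic_process_eta eta_nonneg])
    show "prob_space (M \<Otimes>\<^sub>M colours n)" by (rule P.prob_space_axioms)
    show "expneg (excess {} a / of_nat n) = 1" for a by (simp add: excess_def)
    show "emeasure M {\<omega> \<in> space M. \<forall>t\<in>J. \<eta> t \<omega> \<le> a t} = expneg (excess J a / of_nat n) ^ n" if "finite J" for J a
      unfolding eta_cdf[OF that] by (rule expneg_power[OF n])
  qed (use thinned_nonneg thinned_joint_cdf[OF n] in auto)
qed

end

section \<open>The maximum of the waves is stationary and max-infinitely divisible\<close>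

theorem proposition4p3:
  fixes M :: "'w measure" and N :: "'v measure" and lambda :: real
    and r :: "nat \<Rightarrow> 'w \<Rightarrow> real" and \<phi> :: "nat \<Rightarrow> 'w \<Rightarrow> angle"
    and F :: "real \<Rightarrow> 'v \<Rightarrow> real" and Fs :: "nat \<Rightarrow> real \<Rightarrow> 'w \<Rightarrow> real"
  assumes "lambda > 0"
    and "poisson_point_process M (line_intensity lambda) (\<lambda>i \<omega>. (r i \<omega>, \<phi> i \<omega>))"
    and "measurable_process N F"
    and "\<And>t \<omega>. \<omega> \<in> space N \<Longrightarrow> F t \<omega> \<ge> 0"
    and "\<And>a. a > 0 \<Longrightarrow>
           (\<integral>\<^sup>+ t. emeasure N {\<omega> \<in> space N. F t \<omega> > a} \<partial>lborel) < \<infinity>"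
    and "iid_copies_indep_of M (line_intensity lambda) (\<lambda>i \<omega>. (r i \<omega>, \<phi> i \<omega>)) N F Fs"
  shows "(\<forall>p. AE \<omega> in M. \<exists>i. \<forall>j. wave r \<phi> Fs j p \<omega> \<le> wave r \<phi> Fs i p \<omega>) \<and>
         stationary M (eta r \<phi> Fs) \<and> max_id M (eta r \<phi> Fs)"
proof -
  interpret marked_line_process M N lambda r \<phi> F Fs
    using assms by unfold_locales
  show ?thesis using maximal_wave stationary_eta max_id_eta by blast
qed

end
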